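(* Let $C$ be an $\mathrm{HFP}(2t,4_{\mathbf u})$-code of length $4t$, with generators $a,b$ satisfying $a^{2t}=\mathbf e$, $b^2=\mathbf u$, $\pi_a=(1,2,\ldots,2t)(2t+1,2t+2,\ldots,4t)$ and $\pi_b=(1,2t+1)(2,2t+2)\cdots(2t,4t)$. If $(\mathbf e_{2t},\mathbf u_{2t})\in K(C)$, then the dimension of the kernel of $C$ is $k=2$ and there exists a circulant Hadamard code of length $2t$.
   Context: Let $\mathbb F$ be the binary field. $C_m$ denotes the cyclic group of order $m$. $\mathbf e_n$ is the all-zero vector and $\mathbf u_n$ the all-one vector of length $n$ (subscripts omitted when clear); $(\mathbf e_{2t},\mathbf u_{2t})\in\mathbb F^{4t}$ is their concatenation. For $\pi\in S_n$ and $x\in\mathbb F^n$, $\pi(x)=(x_{\pi^{-1}(1)},\ldots,x_{\pi^{-1}(n)})$. A Hadamard code of length $n=4t$ is a set of $2n$ binary vectors consisting of the rows of a binary Hadamard matrix (a Hadamard matrix with $1$ replaced by $0$ and $-1$ replaced by $1$) and their complements. All codes are assumed to contain $\mathbf e$. A binary code $C\subseteq\mathbb F^n$ has a propelinear structure if for each $x\in C$ there is $\pi_x\in S_n$ such that for all $y\in C$: $x+\pi_x(y)\in C$, and $\pi_x\pi_y=\pi_z$ where $z=x+\pi_x(y)$. Then $C$ is a group under $x*y=x+\pi_x(y)$ (written multiplicatively), with identity $\mathbf e$. A Hadamard full propelinear code (HFP-code) is a Hadamard code with a propelinear structure such that $\pi_x$ has no fixed coordinate for every $x\in C\setminus\{\mathbf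 e,\mathbf u\}$, and $\pi_{\mathbf e}=\pi_{\mathbf u}=I$. An $\mathrm{HFP}(2t,4_{\mathbf u})$-code of length $4t$ is an HFP-code $C=\langle a\rangle\times\langle b\rangle\simeq C_{2t}\times C_4$ with $a^{2t}=\mathbf e$, $b^2=\mathbf u$. The kernel of $C$ is $K(C)=\{z\in\mathbb F^n : C+z=C\}$, a linear subspace contained in $C$; $k=\dim K(C)$. A circulant matrix is a square matrix whose rows are the successive cyclic shifts of a vector. A circulant Hadamard code is the binary code consisting of the rows, and their complements, of a binary normalized Hadamard matrix obtained by normalizing a circulant Hadamard matrix (so a circulant Hadamard code of length $m$ exists iff a circulant Hadamard matrix of order $m$ exists).
   Formalization: The formal statement assumes t > 2: for t = 1 and t = 2 codes satisfying all the hypotheses exist, but Hadamard codes of length 4 and 8 are linear, so k = 3 and k = 4 respectively and the claim k = 2 fails. *)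

theory Defs
  imports
    "HOL-Library.Z2"
    "HOL-Algebra.Elementary_Groups"
    "HOL-Combinatorics.Cycles"
    "Jordan_Normal_Form.VS_Connect"
begin

text \<open>
  The binary field is the type \<^typ>\<open>bit\<close>, and words of length \<open>n\<close> are the elements of
  \<open>carrier_vec n\<close>.  Coordinates are numbered \<open>0, ..., n - 1\<close> instead of \<open>1, ..., n\<close>.
\<close>

definition ones_vec :: "nat \<Rightarrow> bit vec" where
  "ones_vec n = vec n (\<lambda>_. 1)"

definition permute_vec :: "(nat \<Rightarrow> nat) \<Rightarrow> bit vec \<Rightarrow> bit vec" where
  "permute_vec p x = vec (dim_vec x) (\<lambda>i. x $ (inv_into UNIV p i))"

definition hadamard_matrix :: "nat \<Rightarrow> int mat \<Rightarrow> bool" where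
  "hadamard_matrix n H \<longleftrightarrow>
     H \<in> carrier_mat n n \<and>
     (\<forall>i<n. \<forall>j<n. H $$ (i, j) \<in> {1, -1}) \<and>
     H * H\<^sup>T = int n \<cdot>\<^sub>m 1\<^sub>m n"

definition binary_matrix :: "int mat \<Rightarrow> bit mat" where
  "binary_matrix H = map_mat (\<lambda>x. if x = 1 then 0 else 1) H"

definition rows_code :: "bit mat \<Rightarrow> bit vec set" where
  "rows_code B = set (rows B) \<union> (\<lambda>r. r + ones_vec (dim_col B)) ` set (rows B)"

definition hadamard_code :: "nat \<Rightarrow> bit vec set \<Rightarrow> bool" where
  "hadamard_code n C \<longleftrightarrow>
     (\<exists>H. hadamard_matrix n H \<and> C = rows_code (binary_matrix H)) \<and> 0\<^sub>v n \<in> C"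

text \<open>
  The permutations \<open>\<pi> x\<close> matter for codewords \<open>x\<close> only.
\<close>

definition propelinear :: "nat \<Rightarrow> bit vec set \<Rightarrow> (bit vec \<Rightarrow> nat \<Rightarrow> nat) \<Rightarrow> bool" where
  "propelinear n C \<pi> \<longleftrightarrow>
     C \<subseteq> carrier_vec n \<and>
     (\<forall>x\<in>C. \<pi> x permutes {0..<n}) \<and>
     (\<forall>x\<in>C. \<forall>y\<in>C. x + permute_vec (\<pi> x) y \<in> C \<and>
        \<pi> x \<circ> \<pi> y = \<pi> (x + permute_vec (\<pi> x) y))"

definition code_group :: "nat \<Rightarrow> bit vec set \<Rightarrow> (bit vec \<Rightarrow> nat \<Rightarrow> nat) \<Rightarrow> bit vec monoid" where
  "code_group n C \<pi> =
     \<lparr>carrier = C, monoid.mult = (\<lambda>x y. x + permute_vec (\<pi> x) y), one = 0\<^sub>v n\<rparr>"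

definition HFP_code :: "nat \<Rightarrow> bit vec set \<Rightarrow> (bit vec \<Rightarrow> nat \<Rightarrow> nat) \<Rightarrow> bool" where
  "HFP_code n C \<pi> \<longleftrightarrow>
     hadamard_code n C \<and> propelinear n C \<pi> \<and>
     (\<forall>x \<in> C - {0\<^sub>v n, ones_vec n}. \<forall>i<n. \<pi> x i \<noteq> i) \<and>
     \<pi> (0\<^sub>v n) = id \<and> \<pi> (ones_vec n) = id"

text \<open>
  The first \<open>iso\<close> condition says that the code is the internal direct product of the subgroups
  generated by \<open>a\<close> and \<open>b\<close>.
\<close>

definition HFP_2t_4u_code ::
    "nat \<Rightarrow> bit vec set \<Rightarrow> (bit vec \<Rightarrow> nat \<Rightarrow> nat) \<Rightarrow> bit vec \<Rightarrow> bit vec \<Rightarrow> bool" where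
  "HFP_2t_4u_code t C \<pi> a b \<longleftrightarrow>
     HFP_code (4 * t) C \<pi> \<and> a \<in> C \<and> b \<in> C \<and>
     (let G = code_group (4 * t) C \<pi>; A = subgroup_generated G {a}; B = subgroup_generated G {b}
      in (\<lambda>(x, y). x \<otimes>\<^bsub>G\<^esub> y) \<in> iso (A \<times>\<times> B) G \<and>
         A \<cong> integer_mod_group (2 * t) \<and> B \<cong> integer_mod_group 4 \<and>
         a [^]\<^bsub>G\<^esub> (2 * t) = 0\<^sub>v (4 * t) \<and> b [^]\<^bsub>G\<^esub> (2::nat) = ones_vec (4 * t))"

definition double_cycle :: "nat \<Rightarrow> nat \<Rightarrow> nat" where
  "double_cycle t = cycle_of_list [0..<2 * t] \<circ> cycle_of_list [2 * t..<4 * t]"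

definition half_swap :: "nat \<Rightarrow> nat \<Rightarrow> nat" where
  "half_swap t i =
     (if i < 2 * t then i + 2 * t else if i < 4 * t then i - 2 * t else i)"

definition code_kernel :: "nat \<Rightarrow> bit vec set \<Rightarrow> bit vec set" where
  "code_kernel n C = {z \<in> carrier_vec n. (\<lambda>c. c + z) ` C = C}"

definition code_kernel_dim :: "nat \<Rightarrow> bit vec set \<Rightarrow> nat" where
  "code_kernel_dim n C =
     vectorspace.dim class_ring ((module_vec TYPE(bit) n)\<lparr>carrier := code_kernel n C\<rparr>)"

definition circulant_matrix :: "nat \<Rightarrow> int mat \<Rightarrow> bool" where
  "circulant_matrix n H \<longleftrightarrow> (\<exists>v \<in> carrier_vec n. H = mat n n (\<lambda>(i, j). v $ ((j + n - i) mod n)))"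

text \<open>
  Normalizing negates rows and columns so that the first row and the first column become all-one.
\<close>

definition normalization_of :: "nat \<Rightarrow> int mat \<Rightarrow> int mat \<Rightarrow> bool" where
  "normalization_of n H N \<longleftrightarrow>
     (\<exists>r c. (\<forall>i<n. r i \<in> {1, -1}) \<and> (\<forall>j<n. c j \<in> {1, -1}) \<and>
        N = mat n n (\<lambda>(i, j). r i * c j * H $$ (i, j))) \<and>
     (\<forall>i<n. N $$ (i, 0) = 1) \<and> (\<forall>j<n. N $$ (0, j) = 1)"

definition circulant_hadamard_code :: "nat \<Rightarrow> bit vec set \<Rightarrow> bool" where
  "circulant_hadamard_code n D \<longleftrightarrow>
     (\<exists>H N. hadamard_matrix n H \<and> circulant_matrix n H \<and> normalization_of n H N \<and>
        D = rows_code (binary_matrix N))"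

text \<open>
  Hadamard codes of length 4 and 8 (\<open>t = 1\<close> and \<open>t = 2\<close>) are linear, so their kernel is the whole
  code, of dimension 3 and 4 respectively.  They do occur with all the data considered here:
  for \<open>t = 1\<close> take \<open>a = 0011\<close>, \<open>b = 0110\<close>, where the kernel contains \<open>0011\<close>
  (and there is no circulant Hadamard matrix of order 2);
  for \<open>t = 2\<close> take \<open>a = 00110011\<close>, \<open>b = 00001111\<close>, where the kernel contains \<open>b\<close>.
  Kernel dimension 2 can therefore only be claimed for \<open>t > 2\<close>.
\<close>

end

theory Submission
  imports Defs "HOL-Algebra.Multiplicative_Group"
begin

text \<open>
  Put \<open>n = 2t\<close>, let \<open>w\<close> be the given kernel word and \<open>u\<close> the all-one word, and read a word of length \<open>4t\<close> as a pair of
  \<open>n\<close>-periodic sequences of bits, its two halves.  If \<open>c\<close> is a codeword, so is \<open>c + w\<close>, which differs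
  from \<open>c\<close> by complementing the second half.  Since both words have weight \<open>n\<close>, each half of a codeword
  outside \<open>{0, u, w, w + u}\<close> has weight exactly \<open>t\<close> (\<open>half_weight\<close>).  The permutation of \<open>a\<close> shifts each half
  cyclically, so the halves of \<open>a\<^sup>i\<close> are partial sums of shifts of the halves of \<open>a\<close>, and telescope to
  \<open>S(m) + S(m - i)\<close> for an \<open>n\<close>-periodic \<open>S\<close> (\<open>half_pw\<close>).

  No power of \<open>a\<close> equals \<open>w\<close> or \<open>w + u\<close> (\<open>pw_neq_w\<close>).  Such a power could only be \<open>a\<^sup>t\<close>, and would make
  both halves of \<open>a\<close> \<open>t\<close>-periodic of weight \<open>t\<close>; the sum of either half over \<open>t\<close> consecutive positions
  would be \<open>t/2\<close> modulo 2, but these sums are the two constants in the halves of \<open>a\<^sup>t\<close>, which differ.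
  Two conclusions follow.  First, \<open>a\<^sup>i\<close> lies outside \<open>{0, u, w, w + u}\<close> unless \<open>n\<close> divides \<open>i\<close>, so by the
  weights \<open>S\<close> disagrees with each of its nontrivial shifts in exactly half of the positions: the
  circulant matrix with first row \<open>(-1)\<^bsup>S\<^esup>\<close> is a Hadamard matrix (\<open>S_perfect\<close>,
  \<open>circulant_hadamard_of_perfect_sequence\<close>).  Second, \<open>w\<close> is \<open>a\<^sup>k b\<close> up to complement, so the first half
  of every codeword is that of a power of \<open>a\<close>, up to complement (\<open>first_half_is_power\<close>).

  The kernel is a vector space that is closed under the permutation of \<open>a\<close>.  Suppose that it contains a
  word \<open>z\<close> outside \<open>{0, u, w, w + u}\<close>.  The first half \<open>f\<close> of \<open>z\<close> disagrees with a shift of itself in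
  \<open>0\<close>, \<open>t\<close> or \<open>n\<close> positions, and in \<open>t\<close> positions on average; as the trivial shift contributes \<open>0\<close>, some
  shift by \<open>p\<close> complements \<open>f\<close> (\<open>exists_antiperiod\<close>).  With \<open>x\<close> for the shift by one, \<open>1 + x\<^sup>p\<close> is the
  product of \<open>1 + x\<close> and \<open>1 + x + \<dots> + x\<^bsup>p-1\<^esup>\<close>; so the sum of the first \<open>p\<close> shifts of \<open>z\<close> is a kernel word
  whose first half alternates.  Being a codeword, it yields a shift of \<open>S\<close> that differs from \<open>S\<close> by an
  alternating sequence.  A parity argument at the lags \<open>2\<close> and \<open>t + 2\<close> excludes this if \<open>t > 2\<close>
  (\<open>perfect_sequence_no_alternating_shift\<close>), so that the kernel is \<open>{0, u, w, w + u}\<close> (\<open>kernel_eq\<close>).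
\<close>

section \<open>Periodic binary sequences\<close>

text \<open>
  The default simplification rules for bits turn sums into parity conditions; the proofs below
  compute in the additive group instead.
\<close>

declare add_bit_eq_xor [simp del] mult_bit_eq_and [simp del]

lemma bit_add_self [simp]: "x + x = 0" for x :: bit
  by (cases x) auto

lemma bit_add_self_left [simp]: "x + (x + y) = y" for x y :: bit
  by (simp flip: add.assoc)

lemma bit_add_eq_iff: "x + y = z \<longleftrightarrow> y = x + z" for x y z :: bit
  by auto

text \<open>
  The Hamming weight of one window of length \<open>n\<close>.  Sequences are indexed by integers, so that cyclic
  shifts are plain subtractions of indices and wrap-around is expressed by periodicity.
\<close>

definition wt :: "nat \<Rightarrow> (int \<Rightarrow> bit) \<Rightarrow> nat" where
  "wt n f = card {m \<in> {0..<int n}. f m = 1}"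

lemma wt_eq_sum: "wt n f = (\<Sum>m\<in>{0..<int n}. if f m = 1 then 1 else 0)"
  unfolding wt_def by (subst sum.inter_filter[symmetric]) auto

lemma parity_wt: "of_nat (wt n f) = (\<Sum>m\<in>{0..<int n}. f m)"
proof -
  have "of_nat (if f m = 1 then 1 else 0) = f m" for m
    by (cases "f m") auto
  then show ?thesis
    unfolding wt_eq_sum of_nat_sum by simp
qed

lemma finite_support [simp]: "finite {m. 0 \<le> m \<and> m < int n \<and> P m}"
  by (rule finite_subset[of _ "{0..<int n}"]) auto

lemma wt_const: "wt n (\<lambda>m. c) = (if c = 1 then n else 0)"
  by (simp add: wt_eq_sum)

lemma wt_complement: "wt n (\<lambda>m. f m + 1) = n - wt n f"
proof -
  have "{m \<in> {0..<int n}. f m + 1 = 1} = {0..<int n} - {m \<in> {0..<int n}. f m = 1}"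
    by auto
  then show ?thesis
    by (simp add: wt_def card_Diff_subset[of _ "{0..<int n}"] subset_eq)
qed

lemma periodic_mod:
  fixes f :: "int \<Rightarrow> 'a"
  assumes "\<And>m. f (m + int n) = f m"
  shows "f (m mod int n) = f m"
proof -
  have *: "f (m + int n * int k) = f m" for k m
  proof (induction k)
    case (Suc k)
    then show ?case using assms[of "m + int n * int k"] by (simp add: algebra_simps)
  qed simp
  have "f (m + int n * k) = f m" for k m
  proof (cases "k \<ge> 0")
    case True then show ?thesis using *[of m "nat k"] by simp
  next
    case False then show ?thesis using *[of "m + int n * k" "nat (- k)"] by (simp add: algebra_simps)
  qed
  from this[of "m mod int n" "m div int n"] show ?thesis by simp
qed

lemma periodic_cong:
  fixes f :: "int \<Rightarrow> 'a"
  assumes "\<And>m. f (m + int n) = f m" and "x mod int n = y mod int n"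
  shows "f x = f y"
  using periodic_mod[of f n x, OF assms(1)] periodic_mod[of f n y, OF assms(1)] assms(2) by simp

lemma wt_shift:
  assumes per: "\<And>m. f (m + int n) = f m" and "n > 0"
  shows "wt n (\<lambda>m. f (m - d)) = wt n f"
proof -
  have unshift: "f ((x + d) mod int n - d) = f x" for x
    by (rule periodic_cong[of f n, OF per]) (simp add: mod_simps)
  have "bij_betw (\<lambda>m. (m - d) mod int n) {m \<in> {0..<int n}. f (m - d) = 1} {m \<in> {0..<int n}. f m = 1}"
    by (rule bij_betw_byWitness[where f' = "\<lambda>m. (m + d) mod int n"])
       (use \<open>n > 0\<close> unshift in \<open>auto simp: mod_simps periodic_mod[of f n, OF per]\<close>)
  then show ?thesis
    unfolding wt_def by (rule bij_betw_same_card)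
qed

lemma wt_double:
  assumes "\<And>m. f (m + int n) = f m"
  shows "wt (2 * n) f = 2 * wt n f"
proof -
  have split: "{m \<in> {0..<int (2 * n)}. f m = 1} =
      {m \<in> {0..<int n}. f m = 1} \<union> (\<lambda>m. m + int n) ` {m \<in> {0..<int n}. f m = 1}" (is "?L = ?A \<union> ?B")
  proof (intro equalityI subsetI)
    fix m assume m: "m \<in> ?L"
    show "m \<in> ?A \<union> ?B"
    proof (cases "m < int n")
      case False
      with m have "m - int n \<in> ?A" using assms[of "m - int n"] by auto
      then have "m \<in> ?B" by (rule rev_image_eqI) simp
      then show ?thesis ..
    qed (use m in auto)
  qed (use assms in auto)
  have "card (?A \<union> ?B) = card ?A + card ?B"
    by (intro card_Un_disjoint) auto
  also have "card ?B = card ?A"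
    by (intro card_image) (auto simp: inj_on_def)
  finally show ?thesis
    unfolding wt_def split by simp
qed

text \<open>
  Equivalently, all nontrivial periodic autocorrelations of the sequence \<open>(-1)\<^bsup>s\<^esup>\<close> vanish.
\<close>

definition perfect_sequence :: "nat \<Rightarrow> (int \<Rightarrow> bit) \<Rightarrow> bool" where
  "perfect_sequence n s \<longleftrightarrow>
     (\<forall>m. s (m + int n) = s m) \<and>
     (\<forall>d. \<not> int n dvd d \<longrightarrow> 2 * wt n (\<lambda>m. s m + s (m - d)) = n)"

text \<open>
  Double counting.  As \<open>f\<close> is balanced, every position \<open>m\<close> disagrees with exactly \<open>t\<close> of its \<open>2t\<close> shifts,
  so the \<open>2t\<close> numbers of disagreements add up to \<open>2t\<^sup>2\<close>.  The trivial shift contributes \<open>0\<close>; hence some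
  shift contributes more than \<open>t\<close>, and it can only do so by complementing \<open>f\<close>.
\<close>

lemma exists_antiperiod:
  assumes per: "\<And>m. f (m + int (2 * t)) = f m" and "t > 0"
    and bal: "wt (2 * t) f = t"
    and three: "\<And>p::nat. wt (2 * t) (\<lambda>m. f m + f (m - int p)) = t \<or>
      (\<exists>c. \<forall>m. f m + f (m - int p) = c)"
  shows "\<exists>p::nat. \<forall>m. f (m - int p) = f m + 1"
proof (rule ccontr)
  assume no: "\<nexists>p::nat. \<forall>m. f (m - int p) = f m + 1"
  define T where "T p = wt (2 * t) (\<lambda>m. f m + f (m - int p))" for p :: nat
  have le: "T p \<le> t" for p
    using three[of p]
  proof
    assume "\<exists>c. \<forall>m. f m + f (m - int p) = c"
    then obtain c where c: "\<And>m. f m + f (m - int p) = c" by blast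
    have "f (m - int p) = f m + c" for m
      using c[of m] by (simp add: bit_add_eq_iff)
    with no have "c = 0" by (cases c) auto
    then show ?thesis by (simp add: T_def c wt_const)
  qed (simp add: T_def)
  have T0: "T 0 = 0"
    by (simp add: T_def wt_const)
  have row: "(\<Sum>p<2*t. if f m + f (m - int p) = 1 then 1 else 0) = t" for m
  proof -
    have "(\<Sum>p<2*t. if f m + f (m - int p) = 1 then 1 else 0) = card {p \<in> {..<2*t}. f m + f (m - int p) = 1}"
      by (subst sum.inter_filter[symmetric]) auto
    also have "\<dots> = card {k \<in> {0..<int (2*t)}. f m + f k = 1}" (is "card ?P = card ?K")
    proof (rule bij_betw_same_card)
      have unshift: "f (m - (m - x) mod int (2*t)) = f x" for x
        by (rule periodic_cong[of f "2*t", OF per]) (simp add: mod_simps)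
      show "bij_betw (\<lambda>p. (m - int p) mod int (2*t)) ?P ?K"
        by (rule bij_betw_byWitness[where f' = "\<lambda>k. nat ((m - k) mod int (2*t))"])
           (use \<open>t > 0\<close> unshift in \<open>auto simp: mod_simps periodic_mod[of f "2*t", OF per, simplified] nat_less_iff\<close>)
    qed
    also have "\<dots> = wt (2*t) (\<lambda>k. f k + f m)"
      by (simp add: wt_def add.commute)
    also have "\<dots> = t"
      using bal by (cases "f m") (simp_all add: wt_complement)
    finally show ?thesis .
  qed
  have "(\<Sum>p<2*t. T p) = (\<Sum>m\<in>{0..<int (2*t)}. \<Sum>p<2*t. if f m + f (m - int p) = 1 then 1 else 0)"
    unfolding T_def wt_eq_sum by (rule sum.swap)
  also have "\<dots> = 2 * t * t"
    unfolding row by (simp add: nat_mult_distrib)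
  finally have total: "(\<Sum>p<2*t. T p) = 2 * t * t" .
  have "(\<Sum>p<2*t. T p) < (\<Sum>p<2*t. t)"
    by (rule sum_strict_mono_ex1) (use le T0 \<open>t > 0\<close> in \<open>auto intro!: bexI[of _ 0]\<close>)
  with total show False by simp
qed

lemma alternating_shift:
  fixes g :: "int \<Rightarrow> bit"
  assumes alt: "\<And>m. g (m - 1) = g m + 1"
  shows "g (m - k) = g m + of_bool (odd k)"
proof (induction k rule: int_induct[where k = 0])
  case (step1 i)
  have "g (m - (i + 1)) = g (m - i) + 1"
    using alt[of "m - i"] by (simp add: algebra_simps)
  with step1 show ?case by (auto simp: add.assoc)
next
  case (step2 i)
  have "g (m - (i - 1)) = g (m - i) + 1"
    using alt[of "m - (i - 1)"] by (simp add: algebra_simps)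
  with step2 show ?case by (auto simp: add.assoc)
qed simp

text \<open>
  Applying the shift by \<open>k\<close> twice forces \<open>k\<close> to be \<open>t\<close> modulo \<open>2t\<close>, and \<open>t\<close> to be even.  Let \<open>D\<close> be the
  difference of \<open>s\<close> at lag \<open>2\<close>.  The differences at the lags \<open>2\<close> and \<open>t + 2\<close> are \<open>D\<close> and \<open>D + g\<close>; both are
  \<open>t\<close>-periodic of weight \<open>t\<close>, and so have weight \<open>t/2\<close> on a window of length \<open>t\<close>.  On this window the sum
  of \<open>D\<close> telescopes to \<open>1\<close>, which makes \<open>t/2\<close> odd.  But \<open>g\<close> also has weight \<open>t/2\<close> there, so the sum of
  \<open>D + g\<close> is \<open>1 + 1 = 0\<close>, which makes \<open>t/2\<close> even.  The two lags are nontrivial because \<open>t > 2\<close>.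
\<close>

lemma perfect_sequence_no_alternating_shift:
  assumes perfect: "perfect_sequence (2 * t) s" and "t > 2"
    and alt: "\<And>m. g (m - 1) = g m + 1"
    and shift: "\<And>m. s (m - k) = s m + g m"
  shows False
proof -
  note galt = alternating_shift[of g, OF alt]
  have per: "s (m + int (2 * t)) = s m" for m
    using perfect by (simp add: perfect_sequence_def)
  have cor: "wt (2 * t) (\<lambda>m. s m + s (m - d)) = t" if "\<not> int (2 * t) dvd d" for d
    using perfect that unfolding perfect_sequence_def by simp
  have lag: "s (m - d) = s m" if "int (2 * t) dvd d" for m d
  proof (rule periodic_cong[of s "2*t", OF per])
    show "(m - d) mod int (2 * t) = m mod int (2 * t)"
      using that by (metis diff_zero dvd_imp_mod_0 mod_diff_right_eq)
  qed
  have twice: "s (m - 2 * k) = s m + of_bool (odd k)" for m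
    using shift[of "m - k"] shift[of m] galt[of m k] by (simp add: algebra_simps)
  have "even k"
  proof (rule ccontr)
    assume "odd k"
    then have one: "s m + s (m - 2 * k) = 1" for m
      by (simp add: twice)
    show False
    proof (cases "int (2 * t) dvd 2 * k")
      case True
      from one[of 0] lag[OF True, of 0] show False by simp
    next
      case False
      from cor[OF this] one \<open>t > 2\<close> show False by (simp add: wt_const)
    qed
  qed
  have "int (2 * t) dvd 2 * k"
  proof (rule ccontr)
    assume "\<not> int (2 * t) dvd 2 * k"
    from cor[OF this] \<open>t > 2\<close> twice \<open>even k\<close> show False by (simp add: wt_const)
  qed
  then have tk: "int t dvd k" by simp
  have ntk: "\<not> int (2 * t) dvd k"
  proof
    assume "int (2 * t) dvd k"
    from lag[OF this] shift have "g m = 0" for m by (metis add.right_neutral add_left_cancel)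
    with alt[of 0] show False by simp
  qed
  have "int (2 * t) dvd k - int t"
  proof -
    from tk obtain j where j: "k = int t * j" by blast
    with ntk have "odd j" by auto
    then obtain i where "j = 2 * i + 1" by (rule oddE)
    with j have "k - int t = int (2 * t) * i" by (simp add: algebra_simps)
    then show ?thesis by simp
  qed
  then have half: "s (m - int t) = s m + g m" for m
    using lag[of "k - int t" "m - int t"] shift[of m] by simp
  have "even t"
  proof -
    have "even (k - int t)"
      using \<open>int (2 * t) dvd k - int t\<close> by (metis dvd_mult_left of_nat_mult of_nat_numeral)
    with \<open>even k\<close> show ?thesis by simp
  qed
  define D where "D m = s m + s (m - 2)" for m
  have g_per: "g (m - int t) = g m" for m
    using galt[of m "int t"] \<open>even t\<close> by simp
  have g2: "g (m - 2) = g m" for m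
    using galt[of m 2] by simp
  have D_per: "D (m - int t) = D m" for m
    using half[of m] half[of "m - 2"] g2[of m] by (simp add: D_def algebra_simps)
  have D_wt: "wt (2 * t) D = t"
  proof -
    have "\<not> int (2 * t) dvd 2"
      using \<open>t > 2\<close> by (auto dest: zdvd_imp_le)
    from cor[OF this] show ?thesis by (simp add: D_def[abs_def])
  qed
  have Dg_wt: "wt (2 * t) (\<lambda>m. D m + g m) = t"
  proof -
    have "\<not> int (2 * t) dvd int t + 2"
      using \<open>t > 2\<close> by (auto dest: zdvd_imp_le)
    from cor[OF this] show ?thesis
      using half[of "_ - 2"] g2 by (simp add: D_def[abs_def] algebra_simps)
  qed
  have D_half: "2 * wt t D = t"
    using D_wt D_per[of "_ + int t"] by (simp add: wt_double)
  have Dg_half: "2 * wt t (\<lambda>m. D m + g m) = t"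
    using Dg_wt D_per[of "_ + int t"] g_per[of "_ + int t"] by (simp add: wt_double)
  have D_sum: "(\<Sum>m\<in>{0..<int t}. D m) = 1"
  proof -
    have "(\<Sum>m\<in>{0..<int r}. D m) = s (int r - 1) + s (int r - 2) + (s (-1) + s (-2))" for r
    proof (induction r)
      case (Suc r)
      have "{0..<int (Suc r)} = insert (int r) {0..<int r}" by auto
      with Suc show ?case by (simp add: D_def algebra_simps)
    qed simp
    moreover have "s (int t - 1) = s (-1) + g (-1)" "s (int t - 2) = s (-2) + g (-2)"
      using half[of "int t - 1"] half[of "int t - 2"] g_per[of "int t - 1"] g_per[of "int t - 2"] 
      by (simp_all add: add.assoc)
    moreover have "g (-2) = g (-1) + 1" using alt[of "-1"] by simp
    ultimately show ?thesis by (simp add: algebra_simps)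
  qed
  have g_sum: "(\<Sum>m\<in>{0..<int t}. g m) = of_nat (t div 2)"
  proof -
    have "(\<Sum>m\<in>{0..<int (2 * r)}. g m) = of_nat r" for r
    proof (induction r)
      case (Suc r)
      have "{0..<int (2 * Suc r)} = insert (2 * int r + 1) (insert (2 * int r) {0..<int (2 * r)})" by auto
      moreover have "g (2 * int r) = g (2 * int r + 1) + 1"
        using alt[of "2 * int r + 1"] by simp
      ultimately show ?case using Suc by (simp add: algebra_simps)
    qed simp
    from this[of "t div 2"] \<open>even t\<close> show ?thesis by simp
  qed
  have "of_nat (t div 2) = (1 :: bit)"
    using parity_wt[of t D] D_sum D_half by (metis nonzero_mult_div_cancel_left zero_neq_numeral)
  moreover have "of_nat (t div 2) = (1 :: bit) + of_nat (t div 2)"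
    using parity_wt[of t "\<lambda>m. D m + g m"] D_sum g_sum Dg_half
    by (metis nonzero_mult_div_cancel_left sum.distrib zero_neq_numeral)
  ultimately show False by simp
qed

section \<open>Circulant Hadamard matrices and weights in Hadamard codes\<close>

definition bit_sign :: "bit \<Rightarrow> int" where
  "bit_sign x = (if x = 1 then -1 else 1)"

lemma bit_sign_mult: "bit_sign x * bit_sign y = 1 - 2 * (if x + y = 1 then 1 else 0)"
  by (cases x; cases y) (auto simp: bit_sign_def)

text \<open>
  The rows of the circulant matrix are the shifts of the sequence \<open>(-1)\<^bsup>s\<^esup>\<close>, so the inner products of
  distinct rows are the nontrivial autocorrelations.  Any Hadamard matrix can be normalized, by dividing
  each row by its first entry and then each column by its first entry.
\<close>

lemma circulant_hadamard_of_perfect_sequence: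
  assumes perfect: "perfect_sequence n s" and "n > 0"
  shows "\<exists>D. circulant_hadamard_code n D"
proof -
  have per: "s (m + int n) = s m" for m
    using perfect by (simp add: perfect_sequence_def)
  define v where "v = vec n (\<lambda>j. bit_sign (s (int j)))"
  define H where "H = mat n n (\<lambda>(i, j). v $ ((j + n - i) mod n))"
  have H: "H $$ (i, j) = bit_sign (s (int j - int i))" if "i < n" "j < n" for i j
  proof -
    have "s (int ((j + n - i) mod n)) = s (int j - int i)"
    proof (rule periodic_cong[of s n, OF per])
      have "int (j + n - i) = (int j - int i) + int n"
        using that by (simp add: of_nat_diff)
      then show "int ((j + n - i) mod n) mod int n = (int j - int i) mod int n"
        by (simp add: zmod_int)
    qed
    then show ?thesis using that by (simp add: H_def v_def)
  qed
  have circ: "circulant_matrix n H"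
    unfolding circulant_matrix_def H_def by (rule bexI[of _ v]) (auto simp: v_def)
  have H_carrier: "H \<in> carrier_mat n n" by (simp add: H_def)
  have had: "hadamard_matrix n H"
    unfolding hadamard_matrix_def
  proof (intro conjI)
    show "\<forall>i<n. \<forall>j<n. H $$ (i, j) \<in> {1, -1}"
      by (simp add: H bit_sign_def)
    show "H * H\<^sup>T = int n \<cdot>\<^sub>m 1\<^sub>m n"
    proof (rule eq_matI)
      fix i j assume "i < dim_row (int n \<cdot>\<^sub>m 1\<^sub>m n)" "j < dim_col (int n \<cdot>\<^sub>m 1\<^sub>m n)"
      then have ij: "i < n" "j < n" by auto
      have "(H * H\<^sup>T) $$ (i, j) = (\<Sum>k\<in>{0..<n}. H $$ (i, k) * H $$ (j, k))"
        using ij H_carrier by (simp add: scalar_prod_def)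
      also have "\<dots> = (\<Sum>k\<in>{0..<n}. bit_sign (s (int k - int i)) * bit_sign (s (int k - int j)))"
        using ij by (simp add: H)
      also have "\<dots> = (\<Sum>m\<in>int ` {0..<n}. bit_sign (s (m - int i)) * bit_sign (s (m - int j)))"
        by (simp add: sum.reindex)
      also have "\<dots> = (\<Sum>m\<in>{0..<int n}. 1 - 2 * int (if s (m - int i) + s (m - int j) = 1 then 1 else 0))"
        by (simp add: bit_sign_mult image_int_atLeastLessThan if_distrib cong: if_cong)
      also have "\<dots> = int n - 2 * int (wt n (\<lambda>m. s (m - int i) + s (m - int j)))"
        by (simp add: wt_eq_sum sum_subtractf sum_distrib_left)
      also have "wt n (\<lambda>m. s (m - int i) + s (m - int j)) = wt n (\<lambda>m. s m + s (m - (int j - int i)))"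
      proof -
        have "(s (m + int n) + s (m + int n - (int j - int i))) = (s m + s (m - (int j - int i)))" for m
          using per[of m] per[of "m - (int j - int i)"] by (simp add: algebra_simps)
        from wt_shift[of "\<lambda>m. s m + s (m - (int j - int i))" n "int i", OF this \<open>n > 0\<close>]
        show ?thesis by simp
      qed
      also have "int n - 2 * int (wt n (\<lambda>m. s m + s (m - (int j - int i)))) = (if i = j then int n else 0)"
      proof (cases "i = j")
        case True
        then show ?thesis by (simp add: wt_const)
      next
        case False
        have "\<not> int n dvd int j - int i"
        proof
          assume "int n dvd int j - int i"
          then have "int j mod int n = int i mod int n" by (simp add: mod_eq_dvd_iff)
          with ij False show False by simp
        qed
        then have "2 * wt n (\<lambda>m. s m + s (m - (int j - int i))) = n"
          using perfect by (simp add: perfect_sequence_def)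
        then have "2 * int (wt n (\<lambda>m. s m + s (m - (int j - int i)))) = int n"
          by (metis of_nat_mult of_nat_numeral)
        with False show ?thesis by simp
      qed
      finally show "(H * H\<^sup>T) $$ (i, j) = (int n \<cdot>\<^sub>m 1\<^sub>m n) $$ (i, j)"
        using ij by simp
    qed (use H_carrier in auto)
  qed (fact H_carrier)
  define N where "N = mat n n (\<lambda>(i, j). H $$ (i, 0) * (H $$ (0, 0) * H $$ (0, j)) * H $$ (i, j))"
  have unit: "H $$ (i, j) = 1 \<or> H $$ (i, j) = -1" if "i < n" "j < n" for i j
    using that by (simp add: H bit_sign_def)
  have "normalization_of n H N"
    unfolding normalization_of_def
  proof (intro conjI exI allI impI)
    show "N = mat n n (\<lambda>(i, j). H $$ (i, 0) * (H $$ (0, 0) * H $$ (0, j)) * H $$ (i, j))"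
      by (fact N_def)
  next
    fix i assume "i < n"
    then show "H $$ (i, 0) \<in> {1, -1}" "H $$ (0, 0) * H $$ (0, i) \<in> {1, -1}"
      and "N $$ (i, 0) = 1" "N $$ (0, i) = 1"
      using unit[of i 0] unit[of 0 i] unit[of 0 0] \<open>n > 0\<close> by (auto simp: N_def)
  qed
  with had circ show ?thesis
    unfolding circulant_hadamard_code_def by blast
qed

text \<open>
  The zero word is itself a row or a complemented row, and so the distance of \<open>c\<close> from it is given by the
  orthogonality of two rows of the matrix.
\<close>

lemma hadamard_code_weight:
  assumes "hadamard_code n C" and "c \<in> C"
  shows "c = 0\<^sub>v n \<or> c = ones_vec n \<or> 2 * card {i. i < n \<and> c $ i = 1} = n"
proof -
  from assms(1) obtain H where H: "hadamard_matrix n H" and C: "C = rows_code (binary_matrix H)"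
    and zero: "0\<^sub>v n \<in> C"
    unfolding hadamard_code_def by blast
  have H_carrier: "H \<in> carrier_mat n n" and unit: "\<And>i j. i < n \<Longrightarrow> j < n \<Longrightarrow> H $$ (i, j) \<in> {1, -1}"
    and orth: "H * H\<^sup>T = int n \<cdot>\<^sub>m 1\<^sub>m n"
    using H unfolding hadamard_matrix_def by auto
  define r where "r i = vec n (\<lambda>k. if H $$ (i, k) = 1 then 0 else 1 :: bit)" for i
  have "rows (binary_matrix H) = map r [0..<n]"
    using H_carrier by (auto simp: rows_def binary_matrix_def r_def intro!: eq_vecI)
  moreover have "dim_col (binary_matrix H) = n"
    using H_carrier by (simp add: binary_matrix_def)
  ultimately have C_rows: "\<exists>i<n. \<exists>\<epsilon>. x = vec n (\<lambda>k. r i $ k + \<epsilon>)" if "x \<in> C" for x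
  proof -
    from that \<open>rows (binary_matrix H) = map r [0..<n]\<close> \<open>dim_col (binary_matrix H) = n\<close>
    obtain i where i: "i < n" and "x = r i \<or> x = r i + ones_vec n"
      unfolding C rows_code_def by auto
    then have "x = vec n (\<lambda>k. r i $ k + 0) \<or> x = vec n (\<lambda>k. r i $ k + 1)"
      by (auto simp: r_def ones_vec_def intro!: eq_vecI)
    with i show ?thesis by blast
  qed
  \<comment> \<open>The zero word as a row \<open>i0\<close>, complemented if \<open>\<epsilon>0 = 1\<close>; this row is constant.\<close>
  obtain i0 \<epsilon>0 where i0: "i0 < n" and e0: "0\<^sub>v n = vec n (\<lambda>k. r i0 $ k + \<epsilon>0)"
    using C_rows[OF zero] by blast
  obtain i \<epsilon> where i: "i < n" and e: "c = vec n (\<lambda>k. r i $ k + \<epsilon>)"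
    using C_rows[OF assms(2)] by blast
  have r0: "r i0 $ k = \<epsilon>0" if "k < n" for k
  proof -
    have "0\<^sub>v n $ k = r i0 $ k + \<epsilon>0" using that by (subst e0) simp
    with that show ?thesis by (simp add: bit_add_eq_iff)
  qed
  show ?thesis
  proof (cases "i = i0")
    case True
    then have "c = vec n (\<lambda>k. \<epsilon>0 + \<epsilon>)" using e r0 by auto
    then show ?thesis by (cases "\<epsilon>0 + \<epsilon>") (auto simp: ones_vec_def zero_vec_def)
  next
    case False
    define w where "w = card {k \<in> {0..<n}. r i $ k + \<epsilon>0 = 1}"
    have "0 = (H * H\<^sup>T) $$ (i, i0)"
      using i i0 False by (simp add: orth)
    also have "\<dots> = (\<Sum>k\<in>{0..<n}. H $$ (i, k) * H $$ (i0, k))"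
      using i i0 H_carrier by (simp add: scalar_prod_def)
    also have "\<dots> = (\<Sum>k\<in>{0..<n}. 1 - 2 * int (if r i $ k + \<epsilon>0 = 1 then 1 else 0))"
    proof (rule sum.cong)
      fix k assume "k \<in> {0..<n}"
      then have "k < n" by simp
      with unit[of i k] unit[of i0 k] r0[of k] i i0
      show "H $$ (i, k) * H $$ (i0, k) = 1 - 2 * int (if r i $ k + \<epsilon>0 = 1 then 1 else 0)"
        by (auto simp: r_def)
    qed simp
    also have "\<dots> = int n - 2 * int w"
    proof -
      have "w = (\<Sum>k\<in>{0..<n}. if r i $ k + \<epsilon>0 = 1 then 1 else 0)"
        unfolding w_def by (subst sum.inter_filter[symmetric]) auto
      then show ?thesis
        by (simp add: sum_subtractf sum_distrib_left)
    qed
    finally have w: "2 * w = n" by linarith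
    have "card {k. k < n \<and> c $ k = 1} = (if \<epsilon> = \<epsilon>0 then w else n - w)"
    proof (cases "\<epsilon> = \<epsilon>0")
      case True
      then show ?thesis by (auto simp: w_def e intro!: arg_cong[where f = card])
    next
      case False
      then have "\<epsilon> = \<epsilon>0 + 1" by (cases \<epsilon>; cases \<epsilon>0) auto
      then have "{k. k < n \<and> c $ k = 1} = {0..<n} - {k \<in> {0..<n}. r i $ k + \<epsilon>0 = 1}"
        by (auto simp: e simp flip: add.assoc)
      then have "card {k. k < n \<and> c $ k = 1} = n - w"
        by (simp add: w_def card_Diff_subset subset_eq)
      with False show ?thesis by simp
    qed
    with w show ?thesis by (auto split: if_splits)
  qed
qed

section \<open>Words of length \<open>4t\<close> as pairs of periodic sequences\<close>

text \<open>
  The half number \<open>q\<close> (first \<open>0\<close>, second \<open>1\<close>) of a word of length \<open>4t\<close>, continued periodically to all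
  integer indices.
\<close>

definition half :: "nat \<Rightarrow> nat \<Rightarrow> bit vec \<Rightarrow> int \<Rightarrow> bit" where
  "half t q x m = x $ (2 * t * q + nat (m mod int (2 * t)))"

lemma half_periodic: "half t q x (m + int (2 * t)) = half t q x m"
  by (simp add: half_def)

lemma half_index:
  assumes "q < 2" and "t > 0"
  shows "2 * t * q + nat (m mod int (2 * t)) < 4 * t"
proof -
  have "nat (m mod int (2 * t)) < 2 * t"
    using \<open>t > 0\<close> by (simp add: nat_less_iff)
  with \<open>q < 2\<close> show ?thesis by (cases q) auto
qed

lemma index_half:
  assumes "i < 4 * t"
  shows "x $ i = half t (i div (2 * t)) x (int i)" and "i div (2 * t) < 2"
proof -
  have "nat (int i mod int (2 * t)) = i mod (2 * t)"
    by (simp only: nat_int flip: zmod_int)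
  then show "x $ i = half t (i div (2 * t)) x (int i)"
    unfolding half_def by simp
  show "i div (2 * t) < 2"
    using assms by (intro less_mult_imp_div_less) simp
qed

lemma half_add:
  assumes "x \<in> carrier_vec (4 * t)" "y \<in> carrier_vec (4 * t)" "q < 2" "t > 0"
  shows "half t q (x + y) m = half t q x m + half t q y m"
  using assms half_index[OF assms(3,4), of m] by (simp add: half_def)

lemma half_zero: "q < 2 \<Longrightarrow> t > 0 \<Longrightarrow> half t q (0\<^sub>v (4 * t)) m = 0"
  using half_index[of q t m] by (simp add: half_def)

lemma half_ones: "q < 2 \<Longrightarrow> t > 0 \<Longrightarrow> half t q (ones_vec (4 * t)) m = 1"
  using half_index[of q t m] by (simp add: half_def ones_vec_def)

lemma half_zero_ones:
  assumes "q < 2" "t > 0"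
  shows "half t q (0\<^sub>v (2 * t) @\<^sub>v ones_vec (2 * t)) m = of_nat q"
proof -
  have "nat (m mod int (2 * t)) < 2 * t"
    using \<open>t > 0\<close> by (simp add: nat_less_iff)
  moreover have "q = 0 \<or> q = 1" using \<open>q < 2\<close> by auto
  ultimately show ?thesis
    by (auto simp: half_def ones_vec_def)
qed

lemma half_eqI:
  assumes "x \<in> carrier_vec (4 * t)" "y \<in> carrier_vec (4 * t)"
    and "\<And>q m. q < 2 \<Longrightarrow> half t q x m = half t q y m"
  shows "x = y"
proof (rule eq_vecI)
  fix i assume "i < dim_vec y"
  then have i: "i < 4 * t" using assms(2) by simp
  show "x $ i = y $ i"
    using assms(3)[OF index_half(2)[OF i], of "int i"]
    by (simp only: index_half(1)[OF i, of x] index_half(1)[OF i, of y])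
qed (use assms in simp)

lemma card_support_halves:
  "card {i. i < 4 * t \<and> x $ i = 1} = wt (2 * t) (half t 0 x) + wt (2 * t) (half t 1 x)"
proof -
  have h: "wt (2 * t) (half t q x) = card {i. 2 * t * q \<le> i \<and> i < 2 * t * q + 2 * t \<and> x $ i = 1}" for q
  proof -
    define c where "c = 2 * t * q"
    have "wt (2 * t) (half t q x) = card {m \<in> {0..<int (2 * t)}. x $ (c + nat m) = 1}"
      unfolding wt_def half_def c_def by (rule arg_cong[where f = card]) auto
    also have "\<dots> = card {i. c \<le> i \<and> i < c + 2 * t \<and> x $ i = 1}"
    proof (rule bij_betw_same_card)
      show "bij_betw (\<lambda>m. c + nat m) {m \<in> {0..<int (2 * t)}. x $ (c + nat m) = 1}
          {i. c \<le> i \<and> i < c + 2 * t \<and> x $ i = 1}"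
        by (rule bij_betw_byWitness[where f' = "\<lambda>i. int i - int c"])
           (auto simp: nat_less_iff nat_diff_distrib)
    qed
    finally show ?thesis unfolding c_def .
  qed
  let ?A = "{i. i < 2 * t \<and> x $ i = 1}" and ?B = "{i. 2 * t \<le> i \<and> i < 4 * t \<and> x $ i = 1}"
  have "{i. i < 4 * t \<and> x $ i = 1} = ?A \<union> ?B" by auto
  moreover have "card (?A \<union> ?B) = card ?A + card ?B"
    by (rule card_Un_disjoint) auto
  moreover have "wt (2 * t) (half t 0 x) = card ?A"
    unfolding h by simp
  moreover have "wt (2 * t) (half t 1 x) = card ?B"
    unfolding h by simp
  ultimately show ?thesis by simp
qed

section \<open>Coordinate permutations\<close>

lemma permute_vec_index:
  assumes p: "p permutes {0..<n}" and x: "x \<in> carrier_vec n" and j: "j < n"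
  shows "permute_vec p x $ p j = x $ j"
proof -
  have "p j < dim_vec x" using permutes_in_image[OF p, of j] j x by simp
  then have "permute_vec p x $ p j = x $ (inv_into UNIV p (p j))"
    unfolding permute_vec_def by (rule index_vec)
  then show ?thesis
    by (simp only: permutes_inverses(2)[OF p])
qed

lemma permutes_less: "p permutes {0..<n} \<Longrightarrow> p j < n \<longleftrightarrow> j < n" for p :: "nat \<Rightarrow> nat"
  using permutes_in_image[of p "{0..<n}" j] by simp

lemma permute_vec_eqI:
  assumes p: "p permutes {0..<n}" and x: "x \<in> carrier_vec n" and y: "y \<in> carrier_vec n"
    and eq: "\<And>j. j < n \<Longrightarrow> y $ p j = x $ j"
  shows "permute_vec p x = y"
proof (rule eq_vecI)
  fix i assume "i < dim_vec y"
  define j where "j = inv_into UNIV p i"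
  have pj: "p j = i" unfolding j_def by (rule permutes_inverses(1)[OF p])
  have "j < n" using permutes_less[OF p, of j] \<open>i < dim_vec y\<close> y pj by simp
  then show "permute_vec p x $ i = y $ i"
    using permute_vec_index[OF p x] eq pj by metis
qed (use x y in \<open>simp add: permute_vec_def\<close>)

lemma permute_vec_carrier: "x \<in> carrier_vec n \<Longrightarrow> permute_vec p x \<in> carrier_vec n"
  unfolding permute_vec_def using vec_carrier[of "dim_vec x"] by (simp only: carrier_vecD)

lemma permute_vec_add:
  assumes p: "p permutes {0..<n}" and x: "x \<in> carrier_vec n" and y: "y \<in> carrier_vec n"
  shows "permute_vec p (x + y) = permute_vec p x + permute_vec p y"
proof (rule permute_vec_eqI[OF p])
  fix j assume j: "j < n"
  have "p j < dim_vec (permute_vec p y)"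
    using permutes_less[OF p, of j] j y by (simp add: permute_vec_def)
  then have "(permute_vec p x + permute_vec p y) $ p j = permute_vec p x $ p j + permute_vec p y $ p j"
    by (rule index_add_vec(1))
  also have "\<dots> = x $ j + y $ j"
    by (simp only: permute_vec_index[OF p x j] permute_vec_index[OF p y j])
  finally show "(permute_vec p x + permute_vec p y) $ p j = (x + y) $ j"
    using j y by simp
qed (use x y in \<open>simp_all add: permute_vec_carrier\<close>)

lemma permute_vec_comp:
  assumes p: "p permutes {0..<n}" and q: "q permutes {0..<n}" and x: "x \<in> carrier_vec n"
  shows "permute_vec (p \<circ> q) x = permute_vec p (permute_vec q x)"
proof (rule permute_vec_eqI[OF permutes_compose[OF q p] x])
  fix j assume j: "j < n"
  then have "q j < n" using permutes_less[OF q, of j] by simp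
  then show "permute_vec p (permute_vec q x) $ (p \<circ> q) j = x $ j"
    using permute_vec_index[OF p permute_vec_carrier[OF x]] permute_vec_index[OF q x j]
    unfolding comp_def by simp
qed (intro permute_vec_carrier x)

lemma permute_vec_ones: "p permutes {0..<n} \<Longrightarrow> permute_vec p (ones_vec n) = ones_vec n"
  by (rule permute_vec_eqI[of p n]) (simp_all add: ones_vec_def permutes_less[of p n])

lemma permute_vec_id: "permute_vec id x = x"
  by (rule eq_vecI) (simp_all add: permute_vec_def)

text \<open>
  Read off from the fact that a cycle maps its list of entries to the rotated list.
\<close>

lemma cycle_of_list_upt:
  assumes "k \<le> j" "j < l"
  shows "cycle_of_list [k..<l] j = (if Suc j = l then k else Suc j)"
proof -
  have "map (cycle_of_list [k..<l]) [k..<l] = rotate1 [k..<l]"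
    using cyclic_rotation[of "[k..<l]" 1] distinct_upt by (simp add: rotate_def)
  then have "map (cycle_of_list [k..<l]) [k..<l] ! (j - k) = rotate1 [k..<l] ! (j - k)"
    by (rule arg_cong)
  moreover have "map (cycle_of_list [k..<l]) [k..<l] ! (j - k) = cycle_of_list [k..<l] j"
    using assms by (simp only: nth_map_upt) simp
  moreover have "rotate1 [k..<l] ! (j - k) = k + (Suc (j - k) mod (l - k))"
    using assms nth_upt[of k "Suc (j - k) mod (l - k)" l] mod_less_divisor[of "l - k" "Suc (j - k)"]
    by (simp add: nth_rotate1 less_diff_conv)
  moreover have "Suc (j - k) mod (l - k) = (if Suc j = l then 0 else Suc (j - k))"
    using assms by (auto simp: Suc_diff_le[symmetric])
  ultimately show ?thesis
    using assms by (simp split: if_splits)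
qed

lemma double_cycle_eq:
  assumes "q < 2" "j < 2 * t"
  shows "double_cycle t (2 * t * q + j) = 2 * t * q + (if Suc j = 2 * t then 0 else Suc j)"
proof (cases "q = 0")
  case True
  have "cycle_of_list [2 * t..<4 * t] j = j"
    by (rule id_outside_supp) (use assms in simp)
  moreover have "cycle_of_list [0..<2 * t] j = (if Suc j = 2 * t then 0 else Suc j)"
    by (rule cycle_of_list_upt) (use assms in simp_all)
  ultimately show ?thesis
    unfolding double_cycle_def comp_def True by (simp only: mult_0_right add_0_left)
next
  case False
  with assms have q: "q = 1" by simp
  define i where "i = cycle_of_list [2 * t..<4 * t] (2 * t + j)"
  have "i = (if Suc (2 * t + j) = 4 * t then 2 * t else Suc (2 * t + j))"
    unfolding i_def by (rule cycle_of_list_upt) (use assms in simp_all)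
  then have i: "i = 2 * t + (if Suc j = 2 * t then 0 else Suc j)"
    by (simp split: if_splits)
  have "cycle_of_list [0..<2 * t] i = i"
    by (rule id_outside_supp) (use i in simp)
  then show ?thesis
    unfolding double_cycle_def comp_def q mult_1_right by (fold i_def) (simp only: i)
qed

lemma half_double_cycle:
  assumes "double_cycle t permutes {0..<4 * t}" "x \<in> carrier_vec (4 * t)" "q < 2" "t > 0"
  shows "half t q (permute_vec (double_cycle t) x) m = half t q x (m - 1)"
proof -
  define j where "j = nat ((m - 1) mod int (2 * t))"
  have j: "j < 2 * t" and ij: "int j = (m - 1) mod int (2 * t)"
    using \<open>t > 0\<close> by (simp_all add: j_def nat_less_iff)
  have "m mod int (2 * t) = (int j + 1) mod int (2 * t)"
    unfolding ij mod_add_left_eq by (simp only: diff_add_cancel)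
  also have "\<dots> = int (Suc j mod (2 * t))"
    by (simp add: zmod_int add.commute)
  finally have "nat (m mod int (2 * t)) = (if Suc j = 2 * t then 0 else Suc j)"
    using j by (simp only: nat_int mod_Suc mod_less)
  then have "half t q (permute_vec (double_cycle t) x) m =
      permute_vec (double_cycle t) x $ double_cycle t (2 * t * q + j)"
    by (simp only: half_def double_cycle_eq[OF \<open>q < 2\<close> j])
  also have "\<dots> = x $ (2 * t * q + j)"
    using half_index[OF assms(3,4), of "m - 1"]
    by (intro permute_vec_index[OF assms(1,2)]) (simp add: j_def)
  finally show ?thesis by (simp add: half_def j_def)
qed

section \<open>The dimension of a four-element binary space\<close>

lemma vec_cancel:
  "x \<in> carrier_vec n \<Longrightarrow> y \<in> carrier_vec n \<Longrightarrow> z \<in> carrier_vec n \<Longrightarrow>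
    x + z = y + z \<longleftrightarrow> x = (y :: bit vec)"
  "x \<in> carrier_vec n \<Longrightarrow> y \<in> carrier_vec n \<Longrightarrow> x + y + y = (x :: bit vec)"
proof -
  show self: "x + y + y = x" if "x \<in> carrier_vec n" "y \<in> carrier_vec n" for x y :: "bit vec"
    by (rule eq_vecI) (use that in \<open>simp_all add: add.assoc\<close>)
  show "x + z = y + z \<longleftrightarrow> x = y"
    if "x \<in> carrier_vec n" "y \<in> carrier_vec n" "z \<in> carrier_vec n" for x y z :: "bit vec"
    using self[OF that(1,3)] self[OF that(2,3)] by metis
qed

text \<open>
  The two words form a basis: over the binary field, the nontrivial linear combinations of \<open>x\<close> and \<open>y\<close>
  are \<open>x\<close>, \<open>y\<close> and \<open>x + y\<close>.
\<close>

lemma dim_two_words: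
  fixes x y :: "bit vec"
  assumes x: "x \<in> carrier_vec N" and y: "y \<in> carrier_vec N"
    and neq: "x \<noteq> 0\<^sub>v N" "y \<noteq> 0\<^sub>v N" "x \<noteq> y"
  shows "vectorspace.dim class_ring ((module_vec TYPE(bit) N)\<lparr>carrier := {0\<^sub>v N, x, y, y + x}\<rparr>) = 2"
proof -
  interpret V: vec_space "TYPE(bit)" N .
  let ?W = "{0\<^sub>v N, x, y, y + x}"
  let ?M = "(module_vec TYPE(bit) N)\<lparr>carrier := ?W\<rparr>"
  have xy: "{x, y} \<subseteq> carrier_vec N" using x y by simp
  have double: "v + v = 0\<^sub>v N" if "v \<in> carrier_vec N" for v :: "bit vec"
    by (rule eq_vecI) (use that in simp_all)
  have cancel_right: "v + v' + v' = v" if "v \<in> carrier_vec N" "v' \<in> carrier_vec N" for v v' :: "bit vec"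
    by (rule vec_cancel(2)[OF that])
  have closed: "v + v' \<in> ?W" if "v \<in> ?W" "v' \<in> ?W" for v v'
  proof -
    have 1: "x + y = y + x" using x y by (rule comm_add_vec)
    have 2: "y + (y + x) = x" "x + (y + x) = y"
      using cancel_right[OF x y] cancel_right[OF y x] comm_add_vec[OF x y] x y
      by (metis add_carrier_vec comm_add_vec)+
    have 3: "y + x + y = x" "y + x + x = y"
      using cancel_right[OF x y] cancel_right[OF y x] 1 by simp_all
    show ?thesis
      using that 1 2 3 x y double[OF x] double[OF y] double[of "y + x"] by auto
  qed
  have smult: "c \<cdot>\<^sub>v v \<in> ?W" if "v \<in> ?W" for c :: bit and v
  proof -
    have "v \<in> carrier_vec N" using that x y by auto
    then have "0 \<cdot>\<^sub>v v = 0\<^sub>v N" by (intro eq_vecI) auto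
    with that show ?thesis by (cases c) auto
  qed
  have sub: "submodule class_ring ?W (module_vec TYPE(bit) N)"
    by (intro submodule.intro V.module_axioms)
       (use x y closed smult in \<open>auto simp: module_vec_simps\<close>)
  then have "VectorSpace.subspace class_ring ?W (module_vec TYPE(bit) N)"
    by (intro VectorSpace.subspace.intro V.vectorspace_axioms)
  then interpret W: vectorspace class_ring ?M
    by (rule V.subspace_is_vs)
  have li: "V.lin_indpt {x, y}"
  proof (rule V.finite_lin_indpt2)
    fix c assume "V.lincomb c {x, y} = 0\<^sub>v N"
    then have comb: "c x * x $ i + c y * y $ i = 0" if "i < N" for i
      using V.lincomb_index[OF that xy, of c] that \<open>x \<noteq> y\<close> by simp
    have "c x = 0 \<and> c y = 0"
    proof (rule ccontr)
      assume "\<not> (c x = 0 \<and> c y = 0)"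
      then consider "c x = 1" "c y = 0" | "c x = 0" "c y = 1" | "c x = 1" "c y = 1"
        by (cases "c x"; cases "c y") auto
      then show False
      proof cases
        case 1
        then have "x = 0\<^sub>v N" using comb x by (intro eq_vecI) auto
        with neq show False by simp
      next
        case 2
        then have "y = 0\<^sub>v N" using comb y by (intro eq_vecI) auto
        with neq show False by simp
      next
        case 3
        then have "x = y" using comb x y by (intro eq_vecI) (auto simp: bit_add_eq_iff)
        with neq show False by simp
      qed
    qed
    then show "\<forall>v\<in>{x, y}. c v = 0" by simp
  qed (use xy in simp_all)
  have span: "V.span {x, y} = ?W"
  proof
    show "V.span {x, y} \<subseteq> ?W"
      by (rule V.span_is_subset[OF _ sub]) simp
    have "{x, y} \<subseteq> V.span {x, y}" by (rule V.in_own_span[OF xy])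
    moreover have "0\<^sub>v N \<in> V.span {x, y}" using V.span_zero by simp
    moreover have "y + x \<in> V.span {x, y}"
      using V.span_add1[OF xy, of y x] calculation by simp
    ultimately show "?W \<subseteq> V.span {x, y}" by blast
  qed
  have "W.basis {x, y}"
    unfolding W.basis_def
    using li span V.span_li_not_depend[OF _ sub, of "{x, y}"] by simp
  then have "W.dim = card {x, y}"
    by (intro W.dim_basis) simp_all
  with \<open>x \<noteq> y\<close> show ?thesis by simp
qed

section \<open>The group of the code and its kernel\<close>

text \<open>
  The letters \<open>e\<close>, \<open>u\<close>, \<open>w\<close> below denote the zero word, the all-one word and the word \<open>01\<close> made of two
  constant halves.
\<close>

locale hfp_half_kernel =
  fixes t :: nat and C :: "bit vec set" and \<pi> :: "bit vec \<Rightarrow> nat \<Rightarrow> nat" and a b :: "bit vec"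
  assumes t: "t > 2"
    and code: "HFP_2t_4u_code t C \<pi> a b"
    and pi_a: "\<pi> a = double_cycle t"
    and half_in_kernel: "0\<^sub>v (2 * t) @\<^sub>v ones_vec (2 * t) \<in> code_kernel (4 * t) C"
begin

abbreviation "u \<equiv> ones_vec (4 * t)"
abbreviation "e \<equiv> 0\<^sub>v (4 * t) :: bit vec"
abbreviation "w \<equiv> 0\<^sub>v (2 * t) @\<^sub>v ones_vec (2 * t) :: bit vec"
abbreviation "G \<equiv> code_group (4 * t) C \<pi>"
abbreviation "K \<equiv> code_kernel (4 * t) C"

lemma hadamard: "hadamard_code (4 * t) C"
  and propelinear: "propelinear (4 * t) C \<pi>"
  and pi_e: "\<pi> e = id" and pi_u: "\<pi> u = id"
  and a_in: "a \<in> C" and b_in: "b \<in> C"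
  using code unfolding HFP_2t_4u_code_def HFP_code_def by auto

lemma b_pow: "b [^]\<^bsub>G\<^esub> (2::nat) = u"
  and A_iso: "subgroup_generated G {a} \<cong> integer_mod_group (2 * t)"
  and prod_iso: "(\<lambda>(x, y). x \<otimes>\<^bsub>G\<^esub> y) \<in>
     iso (subgroup_generated G {a} \<times>\<times> subgroup_generated G {b}) G"
  using code unfolding HFP_2t_4u_code_def by (auto simp: Let_def)

lemma C_carrier: "x \<in> C \<Longrightarrow> x \<in> carrier_vec (4 * t)"
  using propelinear unfolding propelinear_def by auto

lemma pi_permutes: "x \<in> C \<Longrightarrow> \<pi> x permutes {0..<4 * t}"
  using propelinear unfolding propelinear_def by auto

lemma mult_closed: "x \<in> C \<Longrightarrow> y \<in> C \<Longrightarrow> x + permute_vec (\<pi> x) y \<in> C"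
  and pi_mult: "x \<in> C \<Longrightarrow> y \<in> C \<Longrightarrow> \<pi> (x + permute_vec (\<pi> x) y) = \<pi> x \<circ> \<pi> y"
  using propelinear unfolding propelinear_def by auto

lemma e_in: "e \<in> C"
  using hadamard by (simp add: hadamard_code_def)

lemma finite_C: "finite C"
  using hadamard by (auto simp: hadamard_code_def rows_code_def)

lemma G_simps: "carrier G = C" "x \<otimes>\<^bsub>G\<^esub> y = x + permute_vec (\<pi> x) y" "\<one>\<^bsub>G\<^esub> = e"
  by (simp_all add: code_group_def)

text \<open>
  Associativity is the compatibility of the permutations with the product.  Right translations are
  injective, since \<open>\<pi> x \<circ> \<pi> z\<close> determines \<open>\<pi> x\<close>; on a finite code they are therefore surjective, which gives
  inverses.
\<close>

lemma group_G: "group G"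
proof (rule groupI; unfold G_simps)
  show "e \<in> C" by (rule e_in)
next
  fix x y assume "x \<in> C" "y \<in> C"
  then show "x + permute_vec (\<pi> x) y \<in> C" by (rule mult_closed)
next
  fix x assume x: "x \<in> C"
  show "e + permute_vec (\<pi> e) x = x"
    using C_carrier[OF x] by (simp add: pi_e permute_vec_id)
next
  fix x y z assume xyz: "x \<in> C" "y \<in> C" "z \<in> C"
  have "permute_vec (\<pi> x) (y + permute_vec (\<pi> y) z) = permute_vec (\<pi> x) y + permute_vec (\<pi> x \<circ> \<pi> y) z"
    using permute_vec_add[OF pi_permutes[OF xyz(1)] C_carrier[OF xyz(2)] permute_vec_carrier[OF C_carrier[OF xyz(3)]]]
      permute_vec_comp[OF pi_permutes[OF xyz(1)] pi_permutes[OF xyz(2)] C_carrier[OF xyz(3)]]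
    by simp
  then show "x + permute_vec (\<pi> x) y + permute_vec (\<pi> (x + permute_vec (\<pi> x) y)) z =
      x + permute_vec (\<pi> x) (y + permute_vec (\<pi> y) z)"
    using xyz by (simp add: pi_mult assoc_add_vec[of _ "4 * t"] C_carrier permute_vec_carrier)
next
  fix z assume z: "z \<in> C"
  have "inj_on (\<lambda>x. x + permute_vec (\<pi> x) z) C"
  proof (rule inj_onI)
    fix x y assume x: "x \<in> C" and y: "y \<in> C"
      and eq: "x + permute_vec (\<pi> x) z = y + permute_vec (\<pi> y) z"
    then have "\<pi> x \<circ> \<pi> z = \<pi> y \<circ> \<pi> z"
      using pi_mult[OF x z] pi_mult[OF y z] by simp
    moreover have "surj (\<pi> z)"
      by (rule permutes_surj[OF pi_permutes[OF z]])
    ultimately have "\<pi> x = \<pi> y"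
      by (simp add: surj_fun_eq)
    with eq show "x = y"
      using vec_cancel(1)[OF C_carrier[OF x] C_carrier[OF y] permute_vec_carrier[OF C_carrier[OF z]]] by simp
  qed
  then have "(\<lambda>x. x + permute_vec (\<pi> x) z) ` C = C"
    by (intro endo_inj_surj finite_C) (use mult_closed z in auto)
  then show "\<exists>y\<in>C. y + permute_vec (\<pi> y) z = e"
    using e_in by (metis (no_types, lifting) imageE)
qed

sublocale G: group G
  by (rule group_G)

lemma u_in: "u \<in> C"
  using G.nat_pow_closed[of b 2] b_in b_pow by (simp add: G_simps)

lemma mult_u: "x \<in> C \<Longrightarrow> x \<otimes>\<^bsub>G\<^esub> u = x + u" and u_mult: "x \<in> C \<Longrightarrow> u \<otimes>\<^bsub>G\<^esub> x = x + u"
  using permute_vec_ones[OF pi_permutes, of x]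
  by (simp_all add: G_simps pi_u permute_vec_id comm_add_vec[of _ "4 * t"] C_carrier u_in)

abbreviation "pw i \<equiv> a [^]\<^bsub>G\<^esub> (i :: nat)"

lemma pw_in: "pw i \<in> C"
  using G.nat_pow_closed[of a i] a_in by (simp add: G_simps)

lemma u_neq_e: "u \<noteq> e"
proof
  assume "u = e"
  then have "u $ 0 = e $ 0" by simp
  with t show False by (simp add: ones_vec_def)
qed

lemma pw_eq_e_iff: "pw i = e \<longleftrightarrow> 2 * t dvd i"
proof -
  have "card (carrier (subgroup_generated G {a})) = card (carrier (integer_mod_group (2 * t)))"
    using iso_same_card[OF A_iso] .
  also have "\<dots> = 2 * t"
    using t by (simp add: carrier_integer_mod_group nat_mult_distrib)
  finally have "G.ord a = 2 * t"
    using G.generate_pow_card[of a] a_in by (simp add: carrier_subgroup_generated G_simps)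
  then show ?thesis
    using G.pow_eq_id[of a i] a_in by (simp add: G_simps)
qed

lemma cyclic_carrier:
  assumes "x \<in> C"
  shows "carrier (subgroup_generated G {x}) = {x [^]\<^bsub>G\<^esub> k |k. k \<in> (UNIV :: nat set)}"
  using G.generate_pow_on_finite_carrier[of x] finite_C assms
  by (simp add: carrier_subgroup_generated G_simps)

lemma mem_cyclic: "x \<in> C \<Longrightarrow> x [^]\<^bsub>G\<^esub> (k :: nat) \<in> carrier (subgroup_generated G {x})"
  by (auto simp: cyclic_carrier)

text \<open>
  The cyclic subgroups of \<open>a\<close> and \<open>b\<close> meet trivially, and \<open>u = b\<^sup>2\<close> belongs to the second one.
\<close>

lemma pw_neq_u: "pw i \<noteq> u"
proof
  assume eq: "pw i = u"
  let ?A = "subgroup_generated G {a}" and ?B = "subgroup_generated G {b}"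
  have inj: "inj_on (\<lambda>(x, y). x \<otimes>\<^bsub>G\<^esub> y) (carrier ?A \<times> carrier ?B)"
    using prod_iso by (auto simp: iso_def bij_betw_def)
  have A: "pw i \<in> carrier ?A" "e \<in> carrier ?A"
    using mem_cyclic[OF a_in, of i] mem_cyclic[OF a_in, of 0] by (simp_all add: G_simps(3))
  have B: "u \<in> carrier ?B" "e \<in> carrier ?B"
    using mem_cyclic[OF b_in, of 2] mem_cyclic[OF b_in, of 0] b_pow by (simp_all add: G_simps(3))
  have "(\<lambda>(x, y). x \<otimes>\<^bsub>G\<^esub> y) (pw i, e) = (\<lambda>(x, y). x \<otimes>\<^bsub>G\<^esub> y) (e, u)"
    using G.r_one[of "pw i"] G.l_one[of u] pw_in[of i] u_in eq by (simp add: G_simps(1,3))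
  with inj A B have "(pw i, e) = (e, u)"
    by (elim inj_onD) auto
  with u_neq_e show False by simp
qed

text \<open>
  Since \<open>b\<^sup>2 = u\<close>, and multiplication by \<open>u\<close> complements a codeword, the powers of \<open>b\<close> contribute only
  \<open>b\<close> and complements.
\<close>

lemma code_elements:
  assumes "c \<in> C"
  shows "\<exists>i. c = pw i \<or> c = pw i + u \<or> c = pw i \<otimes>\<^bsub>G\<^esub> b \<or> c = pw i \<otimes>\<^bsub>G\<^esub> b + u"
proof -
  let ?A = "subgroup_generated G {a}" and ?B = "subgroup_generated G {b}"
  have "c \<in> (\<lambda>(x, y). x \<otimes>\<^bsub>G\<^esub> y) ` (carrier ?A \<times> carrier ?B)"
    using prod_iso assms by (auto simp: iso_def bij_betw_def G_simps(1))
  then obtain i k :: nat where c: "c = pw i \<otimes>\<^bsub>G\<^esub> (b [^]\<^bsub>G\<^esub> k)"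
    by (auto simp: cyclic_carrier a_in b_in)
  have bb: "b \<otimes>\<^bsub>G\<^esub> b = u"
    using b_pow b_in by (simp add: numeral_2_eq_2 G_simps(1))
  have mem: "x \<in> C \<Longrightarrow> x \<in> carrier G" for x by (simp add: G_simps)
  have uu: "u \<otimes>\<^bsub>G\<^esub> u = e"
    using mult_u[OF u_in] vec_cancel(2)[of e "4 * t" u] C_carrier[OF u_in] by simp
  have ub: "u \<otimes>\<^bsub>G\<^esub> b = b \<otimes>\<^bsub>G\<^esub> u"
    using mult_u[OF b_in] u_mult[OF b_in] by simp
  have "b [^]\<^bsub>G\<^esub> k \<in> {e, u, b, b \<otimes>\<^bsub>G\<^esub> u}"
  proof (induction k)
    case 0 then show ?case by (simp add: G_simps)
  next
    case (Suc k)
    have "b \<otimes>\<^bsub>G\<^esub> u \<otimes>\<^bsub>G\<^esub> b = e"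
      using G.m_assoc[OF mem[OF b_in] mem[OF u_in] mem[OF b_in]] ub
        G.m_assoc[OF mem[OF b_in] mem[OF b_in] mem[OF u_in]] bb uu by simp
    with Suc show ?case
      using G.l_one[OF mem[OF b_in]] bb ub by (auto simp: G_simps(3))
  qed
  moreover have "pw i \<otimes>\<^bsub>G\<^esub> (b \<otimes>\<^bsub>G\<^esub> u) = pw i \<otimes>\<^bsub>G\<^esub> b + u"
    using G.m_assoc[OF mem[OF pw_in] mem[OF b_in] mem[OF u_in], of i]
      mult_u[of "pw i \<otimes>\<^bsub>G\<^esub> b"] G.m_closed[OF mem[OF pw_in] mem[OF b_in], of i]
    by (simp add: G_simps(1))
  ultimately show ?thesis
    using c mult_u[OF pw_in, of i] G.r_one[OF mem[OF pw_in], of i] by (auto simp: G_simps(3))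
qed

lemma kernel_iff: "z \<in> K \<longleftrightarrow> z \<in> carrier_vec (4 * t) \<and> (\<forall>c\<in>C. c + z \<in> C)"
proof -
  have "(\<lambda>c. c + z) ` C = C" if z: "z \<in> carrier_vec (4 * t)" and closed: "\<forall>c\<in>C. c + z \<in> C"
  proof (intro equalityI subsetI)
    fix c assume "c \<in> C"
    then have "c = (c + z) + z" "c + z \<in> C"
      using vec_cancel(2)[OF C_carrier z] closed by simp_all
    then show "c \<in> (\<lambda>c. c + z) ` C" by (rule image_eqI)
  qed (use closed in auto)
  then show ?thesis
    unfolding code_kernel_def by auto
qed

lemma kernel_subset: "z \<in> K \<Longrightarrow> z \<in> C"
  using e_in by (auto simp: kernel_iff)

lemma kernel_add: "x \<in> K \<Longrightarrow> y \<in> K \<Longrightarrow> x + y \<in> K"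
  unfolding kernel_iff
  by (metis C_carrier add_carrier_vec assoc_add_vec)

lemma e_in_kernel: "e \<in> K" and u_in_kernel: "u \<in> K"
proof -
  show "e \<in> K"
    unfolding kernel_iff using C_carrier by simp
  have "c + u \<in> C" if "c \<in> C" for c
    using mult_u[OF that] G.m_closed[of c u] that u_in by (simp add: G_simps(1))
  then show "u \<in> K"
    using C_carrier[OF u_in] by (simp add: kernel_iff)
qed

text \<open>
  The permutation of \<open>x\<close> maps \<open>C\<close> onto the translate \<open>x + C\<close>, and all translates of \<open>C\<close> have the same kernel.
\<close>

lemma kernel_permute:
  assumes z: "z \<in> K" and x: "x \<in> C"
  shows "permute_vec (\<pi> x) z \<in> K"
  unfolding kernel_iff
proof (intro conjI ballI)
  have zc: "z \<in> carrier_vec (4 * t)" using z by (simp add: kernel_iff)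
  then show "permute_vec (\<pi> x) z \<in> carrier_vec (4 * t)" by (rule permute_vec_carrier)
  fix y assume y: "y \<in> C"
  define c where "c = inv\<^bsub>G\<^esub> x \<otimes>\<^bsub>G\<^esub> y"
  have c: "c \<in> C"
    using G.m_closed[OF G.inv_closed, of x y] x y by (simp add: c_def G_simps(1))
  have "x \<otimes>\<^bsub>G\<^esub> c = y"
    using G.inv_solve_left[of c x y] x y c by (simp add: c_def G_simps(1))
  then have y_eq: "y = x + permute_vec (\<pi> x) c" by (simp add: G_simps)
  have "y + permute_vec (\<pi> x) z = x + permute_vec (\<pi> x) (c + z)"
    using permute_vec_add[OF pi_permutes[OF x] C_carrier[OF c] zc] 
      assoc_add_vec[OF C_carrier[OF x] permute_vec_carrier[OF C_carrier[OF c]] permute_vec_carrier[OF zc]]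
    by (simp add: y_eq)
  also have "\<dots> \<in> C"
    using z c by (intro mult_closed x) (simp add: kernel_iff)
  finally show "y + permute_vec (\<pi> x) z \<in> C" .
qed

section \<open>The halves of the codewords\<close>

lemma t_pos: "t > 0"
  using t by simp

lemma mult_in: "x \<in> C \<Longrightarrow> y \<in> C \<Longrightarrow> x \<otimes>\<^bsub>G\<^esub> y \<in> C"
  using G.m_closed[of x y] by (simp add: G_simps(1))

lemma half_a_mult:
  assumes "x \<in> C" "q < 2"
  shows "half t q (a \<otimes>\<^bsub>G\<^esub> x) m = half t q a m + half t q x (m - 1)"
  using half_double_cycle[of t x q m] pi_permutes[OF a_in] assms t_pos
  by (simp add: G_simps(2) pi_a half_add C_carrier a_in permute_vec_carrier)

lemma pw_Suc: "pw (Suc i) = a \<otimes>\<^bsub>G\<^esub> pw i"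
  using G.nat_pow_Suc2[of a i] a_in by (simp add: G_simps(1))

lemma half_pw_Suc: "q < 2 \<Longrightarrow> half t q (pw (Suc i)) m = half t q a m + half t q (pw i) (m - 1)"
  unfolding pw_Suc by (rule half_a_mult[OF pw_in])

text \<open>
  The permutation of \<open>a\<^sup>i\<close> shifts both halves by \<open>i\<close>.
\<close>

lemma half_pw_mult:
  assumes "x \<in> C" "q < 2"
  shows "half t q (pw i \<otimes>\<^bsub>G\<^esub> x) m = half t q (pw i) m + half t q x (m - int i)"
proof (induction i arbitrary: m)
  case 0
  have "pw 0 = e" by (simp add: G_simps(3))
  moreover have "e \<otimes>\<^bsub>G\<^esub> x = x"
    using G.l_one[of x] assms(1) by (simp add: G_simps(1,3))
  ultimately show ?case
    using half_zero[OF assms(2) t_pos] by simp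
next
  case (Suc i)
  have "pw (Suc i) \<otimes>\<^bsub>G\<^esub> x = a \<otimes>\<^bsub>G\<^esub> (pw i \<otimes>\<^bsub>G\<^esub> x)"
    unfolding pw_Suc using G.m_assoc[of a "pw i" x] a_in pw_in assms(1) by (simp add: G_simps(1))
  then have "half t q (pw (Suc i) \<otimes>\<^bsub>G\<^esub> x) m = half t q a m + half t q (pw i \<otimes>\<^bsub>G\<^esub> x) (m - 1)"
    using half_a_mult[OF mult_in[OF pw_in assms(1)] assms(2)] by simp
  also have "half t q (pw i \<otimes>\<^bsub>G\<^esub> x) (m - 1) = half t q (pw i) (m - 1) + half t q x (m - int (Suc i))"
  proof -
    have "m - 1 - int i = m - int (Suc i)" by simp
    then show ?thesis by (simp only: Suc)
  qed
  finally show ?case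
    by (simp only: half_pw_Suc[OF assms(2)] add.assoc)
qed

lemma pw_mod: "pw (i mod (2 * t)) = pw i"
proof -
  have "pw i = pw (i div (2 * t) * (2 * t) + i mod (2 * t))" by (simp only: div_mult_mod_eq)
  also have "\<dots> = pw (i div (2 * t) * (2 * t)) \<otimes>\<^bsub>G\<^esub> pw (i mod (2 * t))"
    using G.nat_pow_mult[of a] a_in by (simp add: G_simps(1))
  also have "pw (i div (2 * t) * (2 * t)) = e"
    unfolding pw_eq_e_iff by simp
  also have "e \<otimes>\<^bsub>G\<^esub> pw (i mod (2 * t)) = pw (i mod (2 * t))"
    using G.l_one[of "pw (i mod (2 * t))"] pw_in by (simp add: G_simps(1,3))
  finally show ?thesis by simp
qed

text \<open>
  A primitive of the half \<open>q\<close> of \<open>a\<close>: its difference at lag one is that half (\<open>S_step\<close>).  It is read off from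
  the diagonal of the table of powers of \<open>a\<close>, which makes it periodic by definition; that the difference
  equation also holds across the wrap-around is the relation \<open>a\<^bsup>2t\<^esup> = e\<close>.
\<close>

definition S :: "nat \<Rightarrow> int \<Rightarrow> bit" where
  "S q m = half t q (pw (nat (m mod int (2 * t)))) m"

lemma S_periodic: "S q (m + int (2 * t)) = S q m"
  unfolding S_def half_periodic by simp

lemma S_step:
  assumes "q < 2"
  shows "S q m = half t q a m + S q (m - 1)"
proof -
  define r where "r = nat ((m - 1) mod int (2 * t))"
  have r: "int r = (m - 1) mod int (2 * t)" using t_pos by (simp add: r_def)
  have "m mod int (2 * t) = (int r + 1) mod int (2 * t)"
    unfolding r mod_add_left_eq by (simp only: diff_add_cancel)
  also have "\<dots> = int (Suc r mod (2 * t))"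
    by (simp add: zmod_int add.commute)
  finally have "S q m = half t q (pw (Suc r)) m"
    by (simp only: S_def nat_int pw_mod)
  then show ?thesis
    by (simp only: half_pw_Suc[OF assms] S_def[of q "m - 1"] r_def)
qed

lemma half_pw:
  assumes "q < 2"
  shows "half t q (pw i) m = S q m + S q (m - int i)"
proof (induction i arbitrary: m)
  case 0
  have "pw 0 = e" by (simp add: G_simps(3))
  then show ?case using half_zero[OF assms t_pos] by simp
next
  case (Suc i)
  have "half t q (pw (Suc i)) m = half t q a m + (S q (m - 1) + S q (m - 1 - int i))"
    by (simp only: half_pw_Suc[OF assms] Suc)
  then show ?case
    by (simp add: S_step[OF assms, of m] add.assoc algebra_simps)
qed

lemma w_in: "w \<in> C"
  by (rule kernel_subset[OF half_in_kernel])

lemma half_w: "q < 2 \<Longrightarrow> half t q w m = of_nat q"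
  by (rule half_zero_ones) (use t_pos in auto)

text \<open>
  The codewords with constant halves, and in the end the kernel.
\<close>

abbreviation "Z \<equiv> {e, u, w, w + u}"

lemma half_Z:
  assumes "c \<in> Z" "q < 2"
  shows "half t q c m = half t q c m'"
  using assms half_zero[OF assms(2) t_pos] half_ones[OF assms(2) t_pos] half_w[OF assms(2)]
  by (auto simp: half_add C_carrier w_in u_in t_pos)

text \<open>
  Let \<open>v\<close> and \<open>v'\<close> be the weights of the two halves.  The weights of the codewords \<open>c\<close> and \<open>c + w\<close> are
  \<open>v + v'\<close> and \<open>v + (2t - v')\<close>; both are \<open>2t\<close>.
\<close>

lemma half_weight:
  assumes c: "c \<in> C" and "c \<notin> Z" and "q < 2"
  shows "wt (2 * t) (half t q c) = t"
proof -
  have cw: "c + w \<in> C" using half_in_kernel c by (simp add: kernel_iff)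
  have cancel: "c + w + w = c"
    by (rule vec_cancel(2)) (use c w_in C_carrier in auto)
  have "w + u = u + w" "e + w = w"
    using C_carrier w_in u_in by (auto intro!: comm_add_vec)
  with cancel \<open>c \<notin> Z\<close> have "c + w \<noteq> e" "c + w \<noteq> u" by auto
  with hadamard_code_weight[OF hadamard cw] 
  have 1: "wt (2 * t) (half t 0 (c + w)) + wt (2 * t) (half t 1 (c + w)) = 2 * t"
    unfolding card_support_halves by simp
  have 2: "wt (2 * t) (half t 0 c) + wt (2 * t) (half t 1 c) = 2 * t"
    using hadamard_code_weight[OF hadamard c] \<open>c \<notin> Z\<close> unfolding card_support_halves by simp
  have "half t q (c + w) m = half t q c m + of_nat q" if "q < 2" for q m
    using that by (simp add: half_add C_carrier c w_in t_pos half_w)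
  then have "half t 0 (c + w) = half t 0 c" "half t 1 (c + w) = (\<lambda>m. half t 1 c m + 1)"
    by fastforce+
  with 1 have "wt (2 * t) (half t 0 c) + (2 * t - wt (2 * t) (half t 1 c)) = 2 * t"
    by (simp add: wt_complement)
  with 2 have "wt (2 * t) (half t 0 c) = t" "wt (2 * t) (half t 1 c) = t"
    by linarith+
  moreover have "q = 0 \<or> q = 1" using \<open>q < 2\<close> by auto
  ultimately show ?thesis by auto
qed

text \<open>
  If both halves of \<open>a\<close> were constant, \<open>a\<close> would be invariant under the shift, and so \<open>a\<^sup>2 = a + a = e\<close>.
\<close>

lemma a_notin_Z: "a \<notin> Z"
proof
  assume "a \<in> Z"
  have "pw 2 = e"
  proof (rule half_eqI)
    fix q m assume q: "(q :: nat) < 2"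
    have "pw 2 = a \<otimes>\<^bsub>G\<^esub> a"
      using pw_Suc[of 1] a_in by (simp add: numeral_2_eq_2 G_simps(1))
    then have "half t q (pw 2) m = half t q a m + half t q a (m - 1)"
      using half_a_mult[OF a_in q] by simp
    then show "half t q (pw 2) m = half t q e m"
      using half_Z[OF \<open>a \<in> Z\<close> q, of m "m - 1"] half_zero[OF q t_pos] by simp
  qed (use pw_in C_carrier in auto)
  then have "2 * t dvd 2" by (simp only: pw_eq_e_iff)
  with t show False by (auto dest: dvd_imp_le)
qed

text \<open>
  Suppose that \<open>a\<^sup>j\<close> has constant halves \<open>d 0\<close> and \<open>d 1\<close> that differ.  Then \<open>a\<^bsup>2j\<^esup> = e\<close>, so that \<open>j\<close> is an odd
  multiple of \<open>t\<close> and \<open>S q\<close> changes by \<open>d q\<close> under the shift by \<open>t\<close>.  Each half of \<open>a\<close> is then \<open>t\<close>-periodic of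
  weight \<open>t\<close>; its sum over \<open>t\<close> consecutive positions is \<open>t/2\<close> modulo 2, and telescopes to \<open>d q\<close>.  This holds
  for both halves, so \<open>d 0 = d 1\<close>.
\<close>

lemma pw_neq_w: "pw j \<noteq> w" "pw j \<noteq> w + u"
proof -
  have False if "pw j \<in> {w, w + u}"
  proof -
    define d where "d q = half t q (pw j) 0" for q
    have d: "S q m + S q (m - int j) = d q" if "q < 2" for q m
      using half_Z[of "pw j" q m 0] that \<open>pw j \<in> {w, w + u}\<close> by (simp add: d_def half_pw)
    have "d 0 \<noteq> d 1"
      using that half_w half_ones[OF _ t_pos] by (auto simp: d_def half_add C_carrier w_in u_in t_pos)
    have "pw (2 * j) = e"
    proof (rule half_eqI)
      fix q m assume q: "(q :: nat) < 2"
      have "half t q (pw (2 * j)) m = (S q m + S q (m - int j)) + (S q (m - int j) + S q (m - int j - int j))"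
      proof -
        have "m - int j - int j = m - int (2 * j)" by simp
        then show ?thesis
          by (simp only: half_pw[OF q] add.assoc bit_add_self_left)
      qed
      also have "\<dots> = 0" by (simp only: d[OF q] bit_add_self)
      finally show "half t q (pw (2 * j)) m = half t q e m"
        by (simp add: half_zero[OF q t_pos])
    qed (use pw_in C_carrier in auto)
    then have "2 * t dvd 2 * j" by (simp only: pw_eq_e_iff)
    then have "t dvd j" by simp
    then obtain k where k: "j = t * k" ..
    have "odd k"
    proof
      assume "even k"
      then have "pw j = e" unfolding pw_eq_e_iff k by auto
      with \<open>d 0 \<noteq> d 1\<close> show False
        by (simp add: d_def half_zero t_pos)
    qed
    have S_half: "S q m + S q (m - int t) = d q" if "q < 2" for q m
    proof -
      from \<open>odd k\<close> obtain i where i: "k = 2 * i + 1" by (rule oddE)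
      have "(m - int j) - (m - int t) = int (2 * t) * - int i"
        by (simp add: k i algebra_simps)
      then have "(m - int j) mod int (2 * t) = (m - int t) mod int (2 * t)"
        by (simp only: mod_eq_dvd_iff dvd_triv_left)
      then have "S q (m - int j) = S q (m - int t)"
        by (rule periodic_cong[of "S q" "2 * t", OF S_periodic])
      with d[OF that, of m] show ?thesis by simp
    qed
    have parity: "(of_nat (t div 2) :: bit) = d q" and "even t" if q: "q < 2" for q
    proof -
      have S_back: "S q (m - int t) = S q m + d q" for m
        using S_half[OF q, of m] by (metis bit_add_self_left)
      have half_a: "half t q a m = S q m + S q (m - 1)" for m
        using S_step[OF q, of m] by (simp add: add.commute add.assoc add.left_commute)
      have "half t q a (m + int t) = half t q a m" for m
        using S_back[of "m + int t"] S_back[of "m + int t - 1"]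
        by (simp add: half_a algebra_simps)
      then have "2 * wt t (half t q a) = wt (2 * t) (half t q a)"
        by (intro wt_double[symmetric])
      also have "\<dots> = t" by (rule half_weight[OF a_in a_notin_Z q])
      finally have wt: "2 * wt t (half t q a) = t" .
      then show "even t" by presburger
      have "(\<Sum>m\<in>{0..<int r}. half t q a m) = S q (int r - 1) + S q (-1)" for r
      proof (induction r)
        case (Suc r)
        have "{0..<int (Suc r)} = insert (int r) {0..<int r}" by auto
        with Suc show ?case by (simp add: half_a add_ac)
      qed simp
      then have "(\<Sum>m\<in>{0..<int t}. half t q a m) = d q"
        using S_half[OF q, of "int t - 1"] by simp
      then show "of_nat (t div 2) = d q"
        using wt parity_wt[of t "half t q a"] by (metis nonzero_mult_div_cancel_left zero_neq_numeral)
    qed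
    from parity[of 0] parity[of 1] \<open>d 0 \<noteq> d 1\<close> show False by simp
  qed
  then show "pw j \<noteq> w" "pw j \<noteq> w + u" by blast+
qed

lemma pw_in_Z: "pw j \<in> Z \<Longrightarrow> 2 * t dvd j"
  using pw_neq_w[of j] pw_neq_u[of j] pw_eq_e_iff[of j] by blast

lemma S_perfect: "perfect_sequence (2 * t) (S 0)"
  unfolding perfect_sequence_def
proof (intro conjI allI impI S_periodic)
  fix d assume d: "\<not> int (2 * t) dvd d"
  define j where "j = nat (d mod int (2 * t))"
  have j: "int j = d mod int (2 * t)" using t_pos by (simp add: j_def)
  have "\<not> 2 * t dvd j"
    using d by (metis int_dvd_int_iff j dvd_mod_iff dvd_refl)
  then have "wt (2 * t) (half t 0 (pw j)) = t"
    using pw_in_Z by (intro half_weight[OF pw_in]) auto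
  moreover have "half t 0 (pw j) = (\<lambda>m. S 0 m + S 0 (m - d))"
  proof
    fix m
    have "(m - int j) mod int (2 * t) = (m - d) mod int (2 * t)"
      unfolding j by (rule mod_diff_right_eq)
    then have "S 0 (m - int j) = S 0 (m - d)"
      by (rule periodic_cong[of "S 0" "2 * t", OF S_periodic])
    then show "half t 0 (pw j) m = S 0 m + S 0 (m - d)" by (simp add: half_pw)
  qed
  ultimately show "2 * wt (2 * t) (\<lambda>m. S 0 m + S 0 (m - d)) = 2 * t"
    by simp
qed

text \<open>
  As \<open>w\<close> is not a power of \<open>a\<close>, even up to complement, it is \<open>a\<^sup>k b\<close> up to complement.  A codeword \<open>a\<^sup>l b\<close> is
  therefore a product of a power of \<open>a\<close> and a word with constant halves.
\<close>

lemma first_half_is_power: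
  assumes "c \<in> C"
  shows "\<exists>j d. \<forall>m. half t 0 c m = half t 0 (pw j) m + d"
proof -
  have add_u: "half t 0 (x + u) m = half t 0 x m + 1" if "x \<in> C" for x m
    using that half_ones[of 0 t m] by (simp add: half_add C_carrier u_in t_pos)
  obtain k where "w = pw k \<otimes>\<^bsub>G\<^esub> b \<or> w = pw k \<otimes>\<^bsub>G\<^esub> b + u"
  proof -
    from code_elements[OF w_in] obtain k where
      "w = pw k \<or> w = pw k + u \<or> w = pw k \<otimes>\<^bsub>G\<^esub> b \<or> w = pw k \<otimes>\<^bsub>G\<^esub> b + u" by blast
    moreover have "w \<noteq> pw k + u"
      using vec_cancel(2)[OF C_carrier[OF pw_in] C_carrier[OF u_in], of k] pw_neq_w(2)[of k] by metis
    ultimately show thesis using pw_neq_w(1)[of k] that by metis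
  qed
  then have w': "pw k \<otimes>\<^bsub>G\<^esub> b \<in> {w, w + u}"
    using vec_cancel(2)[OF C_carrier[OF mult_in[OF pw_in b_in]] C_carrier[OF u_in], of k] by auto
  define d where "d = half t 0 (pw k \<otimes>\<^bsub>G\<^esub> b) 0"
  have d: "half t 0 (pw k \<otimes>\<^bsub>G\<^esub> b) m = d" for m
    unfolding d_def by (rule half_Z) (use w' in auto)
  have b_coset: "\<exists>j. \<forall>m. half t 0 (pw l \<otimes>\<^bsub>G\<^esub> b) m = half t 0 (pw j) m + d" for l
  proof -
    \<comment> \<open>\<open>j\<close> represents \<open>l - k\<close> modulo \<open>2t\<close> without a truncated subtraction.\<close>
    define j where "j = l + (2 * t - 1) * k"
    have "j + k = l + 2 * t * k"
      using t_pos by (cases t) (simp_all add: j_def algebra_simps)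
    then have "pw l = pw (j + k)"
      using pw_mod[of "j + k"] pw_mod[of l] by simp
    also have "\<dots> = pw j \<otimes>\<^bsub>G\<^esub> pw k"
      using G.nat_pow_mult[of a j k] a_in by (simp add: G_simps(1))
    finally have "pw l \<otimes>\<^bsub>G\<^esub> b = pw j \<otimes>\<^bsub>G\<^esub> (pw k \<otimes>\<^bsub>G\<^esub> b)"
      using G.m_assoc[of "pw j" "pw k" b] pw_in b_in by (simp add: G_simps(1))
    then show ?thesis
      using half_pw_mult[OF mult_in[OF pw_in b_in], of 0 j k] d by auto
  qed
  from code_elements[OF assms] obtain l where
    "c = pw l \<or> c = pw l + u \<or> c = pw l \<otimes>\<^bsub>G\<^esub> b \<or> c = pw l \<otimes>\<^bsub>G\<^esub> b + u" by blast
  then consider "c = pw l" | "c = pw l + u" | "c = pw l \<otimes>\<^bsub>G\<^esub> b" | "c = pw l \<otimes>\<^bsub>G\<^esub> b + u"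
    by blast
  then show ?thesis
  proof cases
    case 1
    then show ?thesis by (intro exI[of _ l] exI[of _ 0]) simp
  next
    case 2
    then show ?thesis using add_u[OF pw_in] by blast
  next
    case 3
    then show ?thesis using b_coset by blast
  next
    case 4
    from b_coset[of l] obtain j where "\<forall>m. half t 0 (pw l \<otimes>\<^bsub>G\<^esub> b) m = half t 0 (pw j) m + d" ..
    with add_u[OF mult_in[OF pw_in b_in], of l] 4
    have "\<forall>m. half t 0 c m = half t 0 (pw j) m + (d + 1)" by (simp add: add.assoc)
    then show ?thesis by blast
  qed
qed

lemma kernel_orbit:
  assumes "z \<in> K"
  shows "\<exists>x\<in>K. \<forall>m. half t 0 x m = half t 0 z (m - int p)"
proof (induction p)
  case 0
  show ?case using assms by auto
next
  case (Suc p)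
  then obtain x where x: "x \<in> K" "\<And>m. half t 0 x m = half t 0 z (m - int p)" by blast
  have "half t 0 (permute_vec (\<pi> a) x) m = half t 0 z (m - int (Suc p))" for m
    using half_double_cycle[of t x 0 m] pi_permutes[OF a_in] C_carrier[OF kernel_subset[OF x(1)]] t_pos x(2)
    by (simp add: pi_a algebra_simps)
  with kernel_permute[OF x(1) a_in] show ?case by blast
qed

text \<open>
  A kernel word outside \<open>Z\<close> has an antiperiod \<open>p\<close> in its first half; summing its first \<open>p\<close> shifts inside the
  kernel gives a word whose first half alternates, and this half has the form \<open>S(m) + S(m - j)\<close> up to
  complement.
\<close>

lemma kernel_eq: "K = Z"
proof (intro equalityI subsetI)
  fix z assume "z \<in> Z"
  then show "z \<in> K"
    using e_in_kernel u_in_kernel half_in_kernel kernel_add by auto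
next
  fix z assume z: "z \<in> K"
  show "z \<in> Z"
  proof (rule ccontr)
    assume "z \<notin> Z"
    define f where "f = half t 0 z"
    have "\<exists>p::nat. \<forall>m. f (m - int p) = f m + 1"
    proof (rule exists_antiperiod)
      show "f (m + int (2 * t)) = f m" for m
        unfolding f_def by (rule half_periodic)
      show "wt (2 * t) f = t"
        unfolding f_def using half_weight[OF kernel_subset[OF z] \<open>z \<notin> Z\<close>] by simp
      fix p :: nat
      obtain x where x: "x \<in> K" "\<And>m. half t 0 x m = f (m - int p)"
        using kernel_orbit[OF z, of p] unfolding f_def by blast
      have sum: "half t 0 (z + x) m = f m + f (m - int p)" for m
        using kernel_subset[OF z] kernel_subset[OF x(1)] 
        by (simp add: half_add C_carrier t_pos x(2) f_def)
      have zx: "z + x \<in> C" by (intro kernel_subset kernel_add z x(1))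
      show "wt (2 * t) (\<lambda>m. f m + f (m - int p)) = t \<or> (\<exists>d. \<forall>m. f m + f (m - int p) = d)"
      proof (cases "z + x \<in> Z")
        case True
        from half_Z[OF this, of 0] sum show ?thesis by (metis zero_less_numeral)
      next
        case False
        from half_weight[OF zx this, of 0] show ?thesis by (simp add: sum[abs_def])
      qed
    qed (rule t_pos)
    then obtain p where p: "\<And>m. f (m - int p) = f m + 1" by blast
    \<comment> \<open>\<open>y\<close> is the sum of the first \<open>r\<close> shifts of \<open>z\<close>.\<close>
    have "\<exists>y\<in>K. \<forall>m. half t 0 y m + half t 0 y (m - 1) = f m + f (m - int r)" for r
    proof (induction r)
      case 0
      show ?case
        by (rule bexI[OF _ e_in_kernel]) (simp add: half_zero t_pos)
    next
      case (Suc r)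
      then obtain y where y: "y \<in> K" "\<And>m. half t 0 y m + half t 0 y (m - 1) = f m + f (m - int r)" by blast
      obtain x where x: "x \<in> K" "\<And>m. half t 0 x m = f (m - int r)"
        using kernel_orbit[OF z, of r] unfolding f_def by blast
      have "half t 0 (y + x) m + half t 0 (y + x) (m - 1) = f m + f (m - int (Suc r))" for m
      proof -
        have "half t 0 (y + x) m + half t 0 (y + x) (m - 1) =
            (half t 0 y m + half t 0 y (m - 1)) + (f (m - int r) + f (m - 1 - int r))"
          using kernel_subset[OF y(1)] kernel_subset[OF x(1)]
          by (simp add: half_add C_carrier t_pos x(2) add_ac)
        also have "\<dots> = f m + f (m - 1 - int r)"
          by (simp add: y(2) add_ac)
        finally show ?thesis by (simp add: algebra_simps)
      qed
      with kernel_add[OF y(1) x(1)] show ?case by blast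
    qed
    then obtain y where y: "y \<in> K" "\<And>m. half t 0 y m + half t 0 y (m - 1) = f m + f (m - int p)"
      by blast
    obtain j d where jd: "\<And>m. half t 0 y m = half t 0 (pw j) m + d"
      using first_half_is_power[OF kernel_subset[OF y(1)]] by blast
    define g where "g m = half t 0 (pw j) m" for m
    show False
    proof (rule perfect_sequence_no_alternating_shift[OF S_perfect t])
      show "g (m - 1) = g m + 1" for m
      proof -
        have "g m + g (m - 1) = 1"
          using y(2)[of m] by (simp add: jd g_def p add_ac)
        then show ?thesis by (metis bit_add_self_left)
      qed
      show "S 0 (m - int j) = S 0 m + g m" for m
        by (simp add: g_def half_pw)
    qed
  qed
qed

end

theorem proposition3p23:
  fixes t :: nat
    and C :: "bit vec set"
    and \<pi> :: "bit vec \<Rightarrow> nat \<Rightarrow> nat"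
    and a b :: "bit vec"
  assumes "t > 2"
    and "HFP_2t_4u_code t C \<pi> a b"
    and "\<pi> a = double_cycle t"
    and "\<pi> b = half_swap t"
    and "0\<^sub>v (2 * t) @\<^sub>v ones_vec (2 * t) \<in> code_kernel (4 * t) C"
  shows "code_kernel_dim (4 * t) C = 2 \<and> (\<exists>D. circulant_hadamard_code (2 * t) D)"
proof -
  interpret hfp_half_kernel t C \<pi> a b
    by unfold_locales (use assms in auto)
  have "w \<noteq> e" "u \<noteq> w"
    using half_w[of 1] half_w[of 0] half_zero[of 1 t] half_ones[of 0 t] t_pos
    by (metis of_nat_0 of_nat_1 one_less_numeral_iff semiring_norm(76) zero_less_numeral zero_neq_one)+
  with u_neq_e have "vectorspace.dim class_ring ((module_vec TYPE(bit) (4 * t))\<lparr>carrier := Z\<rparr>) = 2"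
    by (intro dim_two_words C_carrier u_in w_in)
  then have "code_kernel_dim (4 * t) C = 2"
    by (simp only: code_kernel_dim_def kernel_eq)
  moreover have "\<exists>D. circulant_hadamard_code (2 * t) D"
    by (rule circulant_hadamard_of_perfect_sequence[OF S_perfect]) (use t_pos in simp)
  ultimately show ?thesis by blast
qed

end
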